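(* Let $T_x,T_y>1$, let $N_x,N_y\ge 0$ be integers, let $\varepsilon>0$, and put $\Lambda_x=[0,2\pi/T_x]$, $\Lambda_y=[0,2\pi/T_y]$, $\Lambda=\Lambda_x\times\Lambda_y$. Let $\mathcal{Q}^{\varepsilon,(x)}_{N_x}:L^2(\Lambda_x)\to H^{(x)}_{N_x}$ and $\mathcal{Q}^{\varepsilon,(y)}_{N_y}:L^2(\Lambda_y)\to H^{(y)}_{N_y}$ be the one-dimensional stabilized Fourier extension operators, satisfying for all $v\in L^2(\Lambda_x)$ and $w\in L^2(\Lambda_y)$ $$\|v-\mathcal{Q}^{\varepsilon,(x)}_{N_x}v\|_{L^2(\Lambda_x)}\le\inf_{\mathbf c\in\mathbb C^{2N_x+1}}\left(\|v-\mathcal F^{(x)}_{N_x}\mathbf c\|_{L^2(\Lambda_x)}+\varepsilon\|\mathbf c\|_{\ell^2}\right),$$ $$\|w-\mathcal{Q}^{\varepsilon,(y)}_{N_y}w\|_{L^2(\Lambda_y)}\le\inf_{\mathbf d\in\mathbb C^{2N_y+1}}\left(\|w-\mathcal F^{(y)}_{N_y}\mathbf d\|_{L^2(\Lambda_y)}+\varepsilon\|\mathbf d\|_{\ell^2}\right),$$ and assume $\|\mathcal{Q}^{\varepsilon,(x)}_{N_x}\|_{L^2(\Lambda_x)\to L^2(\Lambda_x)}\le\kappa_x$. Let $\mathcal{Q}^{\varepsilon}_{N_x,N_y}=\mathcal{Q}^{\varepsilon,(x)}_{N_x}\otimes\mathcal{Q}^{\varepsilon,(y)}_{N_y}$ on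 $L^2(\Lambda)$. Let $P\subset\mathbb R^2$ be a local physical patch, either rectangular or one-side curved, let $\widehat Q$ be a fixed reference square, and let $\Psi_P:\widehat Q\to P$ be the corresponding map from $\widehat Q$ onto $P$. Assume that $\Psi_P$ is bi-Lipschitz and that, on $\widehat Q$, $$0<J_{P,\min}\le|\det D\Psi_P|\le J_{P,\max}<\infty.$$ Let $f\in L^2(P)$ and let $g_P=f\circ\Psi_P$ be the pulled-back function; after the affine rescaling from $\widehat Q$ to $\Lambda$, the resulting function on $\Lambda$ is still denoted by $g_P$. Let $G_P=\mathcal{Q}^{\varepsilon}_{N_x,N_y}g_P$ be the local Fourier extension approximation on the reference patch (regarded as a function on $\widehat Q$ through the same affine rescaling), and define $F_P(x,y)=G_P(\Psi_P^{-1}(x,y))$ for $(x,y)\in P$. Then $$\|f-F_P\|_{L^2(P)}\le J_{P,\max}^{1/2}\left(\mathcal E_x(g_P)+\kappa_x\,\mathcal E_y(g_P)\right).$$ Equivalently, in terms of the directional best-approximation defects, $$\|f-F_P\|_{L^2(P)}\le J_{P,\max}^{1/2}\left(\mathcal D_x(g_P)+\kappa_x\,\mathcal D_y(g_P)\right).$$ Here $\mathcal E_x,\mathcal E_y$ are the directional reconstruction errors and $\mathcal D_x,\mathcal D_y$ the directional best-approximation defects, both measured on $\Lambda$.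
   Context: Functions are complex-valued. The Fourier spaces are $H^{(x)}_{N_x}=\mathrm{span}\{e^{i\ell t}:|\ell|\le N_x\}$ and $H^{(y)}_{N_y}=\mathrm{span}\{e^{iqs}:|q|\le N_y\}$, restricted to $\Lambda_x$ and $\Lambda_y$ respectively. The synthesis maps are $\mathcal F^{(x)}_{N_x}\mathbf c=\sum_{|\ell|\le N_x}c_\ell e^{i\ell t}$ for $\mathbf c\in\mathbb C^{2N_x+1}$ and $\mathcal F^{(y)}_{N_y}\mathbf d=\sum_{|q|\le N_y}d_q e^{iqs}$ for $\mathbf d\in\mathbb C^{2N_y+1}$. The operators $\mathcal{Q}^{\varepsilon,(x)}_{N_x}$, $\mathcal{Q}^{\varepsilon,(y)}_{N_y}$ are the linear reconstruction operators obtained by least squares stabilized by truncated singular value decomposition with truncation threshold $\varepsilon$; the properties used are those listed in the claim. Points of $\Lambda$ are written $(t,s)$ with $t\in\Lambda_x$, $s\in\Lambda_y$. The tensor-product operator $\mathcal{Q}^{\varepsilon}_{N_x,N_y}$ corresponds to applying the one-dimensional reconstructions successively in the two coordinate directions. For $g\in L^2(\Lambda)$, the directional reconstruction errors are $$\mathcal E_x(g)=\left(\int_{\Lambda_y}\|g(\cdot,s)-\mathcal{Q}^{\varepsilon,(x)}_{N_x}g(\cdot,s)\|_{L^2(\Lambda_x)}^2\,ds\right)^{1/2},\qquad \mathcal E_y(g)=\left(\int_{\Lambda_x}\|g(t,\cdot)-\mathcal{Q}^{\varepsilon,(y)}_{N_y}g(t,\cdot)\|_{L^2(\Lambda_y)}^2\,dt\right)^{1/2},$$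 and the directional best-approximation defects are $$\mathcal D_x(g)=\left(\int_{\Lambda_y}\inf_{\mathbf c(s)\in\mathbb C^{2N_x+1}}\left(\|g(\cdot,s)-\mathcal F^{(x)}_{N_x}\mathbf c(s)\|_{L^2(\Lambda_x)}+\varepsilon\|\mathbf c(s)\|_{\ell^2}\right)^2ds\right)^{1/2},$$ $$\mathcal D_y(g)=\left(\int_{\Lambda_x}\inf_{\mathbf d(t)\in\mathbb C^{2N_y+1}}\left(\|g(t,\cdot)-\mathcal F^{(y)}_{N_y}\mathbf d(t)\|_{L^2(\Lambda_y)}+\varepsilon\|\mathbf d(t)\|_{\ell^2}\right)^2dt\right)^{1/2}.$$ A rectangular patch is a set $[x_L,x_R]\times[y_B,y_T]$. A one-side curved patch is a set of one of the forms $\{x_L\le x\le x_R,\ y_B\le y\le\gamma(x)\}$, $\{x_L\le x\le x_R,\ \gamma(x)\le y\le y_T\}$, $\{y_B\le y\le y_T,\ \gamma(y)\le x\le x_R\}$, $\{y_B\le y\le y_T,\ x_L\le x\le\gamma(y)\}$, where $\gamma$ is a real function locally representing the boundary curve.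
   Formalization: As printed, the bounds fail when the reference square has larger area than Λ; they are proved with J_{P,max}^{1/2} replaced by (J_{P,max}·|Q̂|/|Λ|)^{1/2}, and exactly as printed whenever |Q̂| ≤ |Λ|. *)

theory Defs
  imports "HOL-Analysis.Analysis"
begin

text \<open>
  Elements of \<open>L\<^sup>2(S)\<close> are represented by functions; only their values on \<open>S\<close> matter, and
  functions that agree almost everywhere on \<open>S\<close> represent the same element.
\<close>

definition L2space :: "'a::euclidean_space set \<Rightarrow> ('a \<Rightarrow> complex) set" where
  "L2space S = {v. v \<in> borel_measurable (lebesgue_on S) \<and>
                   integrable (lebesgue_on S) (\<lambda>x. (norm (v x))\<^sup>2)}"

definition L2norm :: "'a::euclidean_space set \<Rightarrow> ('a \<Rightarrow> complex) \<Rightarrow> real" where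
  "L2norm S v = sqrt (\<integral>x. (norm (v x))\<^sup>2 \<partial>lebesgue_on S)"

definition Lam :: "real \<Rightarrow> real set" where
  "Lam T = {0..2 * pi / T}"

text \<open>
  A complex vector of length \<open>2 * N + 1\<close> is represented by a function on the integers, of which only the values at
  the frequencies \<open>- N, \<dots>, N\<close> are ever used.
\<close>

definition fourier_synth :: "nat \<Rightarrow> (int \<Rightarrow> complex) \<Rightarrow> real \<Rightarrow> complex" where
  "fourier_synth N c t = (\<Sum>l\<in>{- int N..int N}. c l * exp (\<i> * of_int l * of_real t))"

definition coeff_norm :: "nat \<Rightarrow> (int \<Rightarrow> complex) \<Rightarrow> real" where
  "coeff_norm N c = L2_set (\<lambda>l. norm (c l)) {- int N..int N}"

definition fourier_space :: "real \<Rightarrow> nat \<Rightarrow> (real \<Rightarrow> complex) set" where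
  "fourier_space T N = {u. \<exists>c. \<forall>t\<in>Lam T. u t = fourier_synth N c t}"

text \<open>
  Linear operators from \<open>L\<^sup>2(S)\<close> to a space \<open>H\<close> of continuous functions on \<open>S\<close>. The second clause
  says that the operator is well defined on classes of functions modulo null sets; the values
  are compared pointwise, since elements of \<open>H\<close> are represented by continuous functions.
\<close>

definition L2_linear_op ::
    "real set \<Rightarrow> (real \<Rightarrow> complex) set \<Rightarrow> ((real \<Rightarrow> complex) \<Rightarrow> real \<Rightarrow> complex) \<Rightarrow> bool" where
  "L2_linear_op S H Q \<longleftrightarrow>
     (\<forall>v\<in>L2space S. Q v \<in> H) \<and>
     (\<forall>v\<in>L2space S. \<forall>w\<in>L2space S.
        (AE t in lebesgue_on S. v t = w t) \<longrightarrow> (\<forall>t\<in>S. Q v t = Q w t)) \<and>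
     (\<forall>v\<in>L2space S. \<forall>w\<in>L2space S. \<forall>t\<in>S. Q (\<lambda>x. v x + w x) t = Q v t + Q w t) \<and>
     (\<forall>v\<in>L2space S. \<forall>a. \<forall>t\<in>S. Q (\<lambda>x. a * v x) t = a * Q v t)"

definition approx_defect :: "real \<Rightarrow> nat \<Rightarrow> real \<Rightarrow> (real \<Rightarrow> complex) \<Rightarrow> real" where
  "approx_defect T N \<epsilon> v =
     (INF c. L2norm (Lam T) (\<lambda>t. v t - fourier_synth N c t) + \<epsilon> * coeff_norm N c)"

text \<open>
  \<open>Qx \<otimes> Qy\<close>: first \<open>Qy\<close> in the second variable, then \<open>Qx\<close> in the first. For \<open>g\<close> in \<open>L\<^sup>2\<close> the
  sections of \<open>g\<close> may fail to be square integrable on a null set of parameters; this does not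
  affect the result, because Lebesgue measure is complete and \<open>Qx\<close> ignores null sets.
\<close>

definition tensor_op ::
    "((real \<Rightarrow> complex) \<Rightarrow> real \<Rightarrow> complex) \<Rightarrow> ((real \<Rightarrow> complex) \<Rightarrow> real \<Rightarrow> complex)
      \<Rightarrow> (real \<times> real \<Rightarrow> complex) \<Rightarrow> real \<times> real \<Rightarrow> complex" where
  "tensor_op Qx Qy g = (\<lambda>(t, s). Qx (\<lambda>t'. Qy (\<lambda>s'. g (t', s')) s) t)"

definition err_x :: "real \<Rightarrow> real \<Rightarrow> ((real \<Rightarrow> complex) \<Rightarrow> real \<Rightarrow> complex)
    \<Rightarrow> (real \<times> real \<Rightarrow> complex) \<Rightarrow> real" where
  "err_x Tx Ty Qx g = sqrt (\<integral>s.
     (L2norm (Lam Tx) (\<lambda>t. g (t, s) - Qx (\<lambda>t'. g (t', s)) t))\<^sup>2 \<partial>lebesgue_on (Lam Ty))"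

definition err_y :: "real \<Rightarrow> real \<Rightarrow> ((real \<Rightarrow> complex) \<Rightarrow> real \<Rightarrow> complex)
    \<Rightarrow> (real \<times> real \<Rightarrow> complex) \<Rightarrow> real" where
  "err_y Tx Ty Qy g = sqrt (\<integral>t.
     (L2norm (Lam Ty) (\<lambda>s. g (t, s) - Qy (\<lambda>s'. g (t, s')) s))\<^sup>2 \<partial>lebesgue_on (Lam Tx))"

definition defect_x :: "real \<Rightarrow> real \<Rightarrow> nat \<Rightarrow> real \<Rightarrow> (real \<times> real \<Rightarrow> complex) \<Rightarrow> real" where
  "defect_x Tx Ty Nx \<epsilon> g = sqrt (\<integral>s.
     (approx_defect Tx Nx \<epsilon> (\<lambda>t. g (t, s)))\<^sup>2 \<partial>lebesgue_on (Lam Ty))"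

definition defect_y :: "real \<Rightarrow> real \<Rightarrow> nat \<Rightarrow> real \<Rightarrow> (real \<times> real \<Rightarrow> complex) \<Rightarrow> real" where
  "defect_y Tx Ty Ny \<epsilon> g = sqrt (\<integral>t.
     (approx_defect Ty Ny \<epsilon> (\<lambda>s. g (t, s)))\<^sup>2 \<partial>lebesgue_on (Lam Tx))"

text \<open>
  Patches of the physical plane. Degenerate parameters are not excluded here; they cannot occur
  for a patch that is a bi-Lipschitz image of a square.
\<close>

definition rectangular_patch :: "(real^2) set \<Rightarrow> bool" where
  "rectangular_patch P \<longleftrightarrow>
     (\<exists>xL xR yB yT. P = {p. xL \<le> p$1 \<and> p$1 \<le> xR \<and> yB \<le> p$2 \<and> p$2 \<le> yT})"

definition one_side_curved_patch :: "(real^2) set \<Rightarrow> bool" where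
  "one_side_curved_patch P \<longleftrightarrow>
     (\<exists>xL xR yB yT. \<exists>\<gamma> :: real \<Rightarrow> real.
        P = {p. xL \<le> p$1 \<and> p$1 \<le> xR \<and> yB \<le> p$2 \<and> p$2 \<le> \<gamma> (p$1)} \<or>
        P = {p. xL \<le> p$1 \<and> p$1 \<le> xR \<and> \<gamma> (p$1) \<le> p$2 \<and> p$2 \<le> yT} \<or>
        P = {p. yB \<le> p$2 \<and> p$2 \<le> yT \<and> \<gamma> (p$2) \<le> p$1 \<and> p$1 \<le> xR} \<or>
        P = {p. yB \<le> p$2 \<and> p$2 \<le> yT \<and> xL \<le> p$1 \<and> p$1 \<le> \<gamma> (p$2)})"

definition ref_square :: "real^2 \<Rightarrow> real \<Rightarrow> (real^2) set" where
  "ref_square a h = {p. a$1 \<le> p$1 \<and> p$1 \<le> a$1 + h \<and> a$2 \<le> p$2 \<and> p$2 \<le> a$2 + h}"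

text \<open>The affine rescaling of \<open>ref_square a h\<close> onto \<open>Lam Tx \<times> Lam Ty\<close>, and its inverse.\<close>

definition square_to_Lam :: "real^2 \<Rightarrow> real \<Rightarrow> real \<Rightarrow> real \<Rightarrow> real^2 \<Rightarrow> real \<times> real" where
  "square_to_Lam a h Tx Ty p =
     ((p$1 - a$1) / h * (2 * pi / Tx), (p$2 - a$2) / h * (2 * pi / Ty))"

definition Lam_to_square :: "real^2 \<Rightarrow> real \<Rightarrow> real \<Rightarrow> real \<Rightarrow> real \<times> real \<Rightarrow> real^2" where
  "Lam_to_square a h Tx Ty z =
     vector [a$1 + h * fst z / (2 * pi / Tx), a$2 + h * snd z / (2 * pi / Ty)]"

definition bi_lipschitz_on :: "'a::metric_space set \<Rightarrow> ('a \<Rightarrow> 'b::metric_space) \<Rightarrow> bool" where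
  "bi_lipschitz_on S F \<longleftrightarrow>
     inj_on F S \<and> (\<exists>L. L-lipschitz_on S F) \<and> (\<exists>M. M-lipschitz_on (F ` S) (the_inv_into S F))"

end

theory Submission
  imports Defs
begin

text \<open>
  Write \<open>g\<close> for the pulled-back function on \<open>\<Lambda> = Lam Tx \<times> Lam Ty\<close> and \<open>G\<close> for its tensor
  reconstruction. Two facts give the theorem.

  On \<open>\<Lambda>\<close>, with \<open>Qx\<close> and \<open>Qy\<close> acting on the slices in the respective variable,
  \<open>g - G = (g - Qx g) + Qx (g - Qy g)\<close>. The norm of the first summand is \<open>err_x\<close> by Tonelli's
  theorem. The second summand is, for almost every \<open>s\<close>, the image under \<open>Qx\<close> of a slice of
  \<open>g - Qy g\<close>, so its norm is at most \<open>\<kappa>x * err_y\<close>. This is \<open>tensor_reconstruction_error\<close>. The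
  version with defects follows by integrating the one-dimensional error bounds
  (\<open>slice_error_le_defect\<close>).

  The change of variables formula for \<open>\<Psi>\<close> together with \<open>\<bar>det\<bar> \<le> Jmax\<close> bounds a norm on the patch
  by \<open>sqrt Jmax\<close> times the norm of the pullback on the square
  (\<open>L2space_bi_lipschitz_pullback\<close>). Squared norms on the square are \<open>\<rho>\<close> times those of the rescaled
  functions on \<open>\<Lambda>\<close> (\<open>L2_Lam_to_square\<close>). The lower bound on the determinant makes \<open>g\<close> square
  integrable to begin with.

  Most of the work lies in the measurability that the first part presupposes: the functions
  \<open>(t, s) \<mapsto> Qy (g (t, \<cdot>)) s\<close> are defined slice by slice through an abstract operator. The range
  of the operator consists of trigonometric polynomials of degree \<open>N\<close>. Such a polynomial is
  determined by its values at \<open>2 * N + 1\<close> nodes (\<open>fourier_synth_interpolation\<close>), and averaging the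
  interpolation formula over translated nodes bounds its values by its \<open>L\<^sup>2\<close> norm
  (\<open>fourier_synth_pointwise_bound\<close>). Hence \<open>v \<mapsto> Q v s\<close> is a bounded linear functional on \<open>L\<^sup>2\<close>, and a
  bounded functional applied to the slices of a square integrable function is measurable in the
  parameter (\<open>L2_functional_slice_measurable\<close>); interpolation then gives joint measurability, and
  it shows that \<open>G\<close> is continuous. The defects are measurable because the infimum may be taken
  over countably many coefficient vectors (\<open>approx_defect_countable\<close>).
\<close>

section \<open>Square integrable functions\<close>

lemma complete_measure_lebesgue_on:
  assumes "S \<in> sets lebesgue"
  shows "complete_measure (lebesgue_on S)"
proof
  fix A B assume "B \<subseteq> A" "A \<in> null_sets (lebesgue_on S)"
  then have "B \<subseteq> S" "B \<in> null_sets lebesgue"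
    using null_sets_completion_subset[of B A lborel] by (auto simp: null_sets_restrict_space[OF assms])
  then show "B \<in> sets (lebesgue_on S)"
    using assms by (simp add: sets_restrict_space_iff null_setsD2)
qed

lemma borel_measurable_lebesgue_on_cong_AE:
  fixes f g :: "'a::euclidean_space \<Rightarrow> 'b::topological_space"
  assumes S: "S \<in> sets lebesgue" and f: "f \<in> borel_measurable (lebesgue_on S)"
    and eq: "AE x in lebesgue_on S. f x = g x"
  shows "g \<in> borel_measurable (lebesgue_on S)"
proof (rule measurableI)
  interpret complete_measure "lebesgue_on S" by (rule complete_measure_lebesgue_on[OF S])
  fix A :: "'b set" assume A: "A \<in> sets borel"
  show "g -` A \<inter> space (lebesgue_on S) \<in> sets (lebesgue_on S)"
  proof (rule in_sets_AE)
    show "f -` A \<inter> space (lebesgue_on S) \<in> sets (lebesgue_on S)"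
      using f A by (rule measurable_sets)
    show "AE x in lebesgue_on S. x \<in> f -` A \<inter> space (lebesgue_on S) \<longleftrightarrow> x \<in> g -` A \<inter> space (lebesgue_on S)"
      using eq by eventually_elim auto
  qed auto
qed auto

lemma L2space_iff_nn_integral:
  "v \<in> L2space S \<longleftrightarrow> v \<in> borel_measurable (lebesgue_on S) \<and>
     (\<integral>\<^sup>+x. ennreal ((norm (v x))\<^sup>2) \<partial>lebesgue_on S) < \<infinity>"
  unfolding L2space_def integrable_iff_bounded by auto

lemma L2norm_nonneg: "0 \<le> L2norm S v"
  by (simp add: L2norm_def)

lemma L2norm_square: "(L2norm S v)\<^sup>2 = (\<integral>x. (norm (v x))\<^sup>2 \<partial>lebesgue_on S)"
  by (simp add: L2norm_def)

lemma nn_integral_eq_L2norm: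
  assumes "v \<in> L2space S"
  shows "(\<integral>\<^sup>+x. ennreal ((norm (v x))\<^sup>2) \<partial>lebesgue_on S) = ennreal ((L2norm S v)\<^sup>2)"
  using assms by (simp add: L2norm_square L2space_def nn_integral_eq_integral)

lemma L2space_cong_AE:
  assumes "S \<in> sets lebesgue" "v \<in> L2space S" "AE x in lebesgue_on S. v x = w x"
  shows "w \<in> L2space S" "L2norm S v = L2norm S w"
proof -
  have w: "w \<in> borel_measurable (lebesgue_on S)"
    using assms borel_measurable_lebesgue_on_cong_AE unfolding L2space_def by blast
  have "AE x in lebesgue_on S. (norm (v x))\<^sup>2 = (norm (w x))\<^sup>2"
    using assms(3) by eventually_elim simp
  then show "w \<in> L2space S" "L2norm S v = L2norm S w"
    using w assms(2) integrable_cong_AE[of "\<lambda>x. (norm (v x))\<^sup>2" "lebesgue_on S" "\<lambda>x. (norm (w x))\<^sup>2"]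
      integral_cong_AE[of "\<lambda>x. (norm (v x))\<^sup>2" "lebesgue_on S" "\<lambda>x. (norm (w x))\<^sup>2"]
    unfolding L2space_def L2norm_def by auto
qed

lemma L2space_cong:
  assumes "S \<in> sets lebesgue" "\<And>x. x \<in> S \<Longrightarrow> v x = w x"
  shows "v \<in> L2space S \<longleftrightarrow> w \<in> L2space S"
proof -
  have "AE x in lebesgue_on S. v x = w x" "AE x in lebesgue_on S. w x = v x"
    using assms(2) by (auto intro!: AE_I2)
  then show ?thesis
    using L2space_cong_AE(1)[OF assms(1)] by blast
qed

lemma L2norm_cong:
  assumes "\<And>x. x \<in> S \<Longrightarrow> v x = w x"
  shows "L2norm S v = L2norm S w"
  unfolding L2norm_def using assms by (auto intro!: Bochner_Integration.integral_cong)

lemma L2space_bound: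
  fixes v :: "'a::euclidean_space \<Rightarrow> complex"
  assumes v: "v \<in> borel_measurable (lebesgue_on S)" and w: "w \<in> L2space S"
    and le: "AE x in lebesgue_on S. norm (v x) \<le> norm (w x)"
  shows "v \<in> L2space S"
proof -
  have "integrable (lebesgue_on S) (\<lambda>x. (norm (v x))\<^sup>2)"
  proof (rule Bochner_Integration.integrable_bound)
    show "integrable (lebesgue_on S) (\<lambda>x. (norm (w x))\<^sup>2)" using w by (simp add: L2space_def)
    show "AE x in lebesgue_on S. norm ((norm (v x))\<^sup>2) \<le> norm ((norm (w x))\<^sup>2)"
      using le by eventually_elim (simp add: power_mono)
  qed (use v in measurable)
  then show ?thesis using v by (simp add: L2space_def)
qed

lemma norm_add_square_weighted:
  fixes x y :: "'a::real_normed_vector" and r :: real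
  assumes "r > 0"
  shows "(norm (x + y))\<^sup>2 \<le> (1 + r) * (norm x)\<^sup>2 + (1 + 1 / r) * (norm y)\<^sup>2"
proof -
  have "(norm (x + y))\<^sup>2 \<le> (norm x + norm y)\<^sup>2"
    by (simp add: norm_triangle_ineq power_mono)
  moreover have "2 * norm x * norm y \<le> r * (norm x)\<^sup>2 + (norm y)\<^sup>2 / r"
  proof -
    have "0 \<le> (r * norm x - norm y)\<^sup>2 / r" using assms by simp
    also have "\<dots> = r * (norm x)\<^sup>2 + (norm y)\<^sup>2 / r - 2 * norm x * norm y"
      using assms by (simp add: field_simps power2_eq_square)
    finally show ?thesis by simp
  qed
  ultimately show ?thesis by (simp add: power2_sum algebra_simps)
qed

lemma L2space_add:
  assumes v: "v \<in> L2space S" and w: "w \<in> L2space S"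
  shows "(\<lambda>x. v x + w x) \<in> L2space S"
proof -
  have m[measurable]: "v \<in> borel_measurable (lebesgue_on S)" "w \<in> borel_measurable (lebesgue_on S)"
    using v w by (auto simp: L2space_def)
  have "integrable (lebesgue_on S) (\<lambda>x. (norm (v x + w x))\<^sup>2)"
  proof (rule Bochner_Integration.integrable_bound)
    show "integrable (lebesgue_on S) (\<lambda>x. 2 * (norm (v x))\<^sup>2 + 2 * (norm (w x))\<^sup>2)"
      using v w by (simp add: L2space_def)
    show "AE x in lebesgue_on S. norm ((norm (v x + w x))\<^sup>2)
        \<le> norm (2 * (norm (v x))\<^sup>2 + 2 * (norm (w x))\<^sup>2)"
      using norm_add_square_weighted[of 1] by (intro AE_I2) auto
  qed measurable
  then show ?thesis by (simp add: L2space_def)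
qed

lemma L2space_mult: "v \<in> L2space S \<Longrightarrow> (\<lambda>x. a * v x) \<in> L2space S"
  by (auto simp: L2space_def norm_mult power_mult_distrib)

lemma L2norm_mult: "L2norm S (\<lambda>x. a * v x) = norm a * L2norm S v"
  by (simp add: L2norm_def norm_mult power_mult_distrib real_sqrt_mult)

lemma L2space_diff:
  assumes "v \<in> L2space S" "w \<in> L2space S"
  shows "(\<lambda>x. v x - w x) \<in> L2space S"
  using L2space_add[OF assms(1) L2space_mult[OF assms(2), of "-1"]] by simp

lemma L2norm_minus_commute: "L2norm S (\<lambda>x. v x - w x) = L2norm S (\<lambda>x. w x - v x)"
  by (simp add: L2norm_def norm_minus_commute)

lemma L2space_zero: "(\<lambda>x. 0) \<in> L2space S"
  by (simp add: L2space_def)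

lemma L2space_sum:
  assumes "\<And>i. i \<in> I \<Longrightarrow> v i \<in> L2space S"
  shows "(\<lambda>x. \<Sum>i\<in>I. v i x) \<in> L2space S"
  using assms by (induction I rule: infinite_finite_induct) (auto simp: L2space_zero L2space_add)

text \<open>
  Integrating \<open>norm_add_square_weighted\<close> bounds the square of the left side for every weight
  \<open>r\<close>; the quotient of the two norms is the weight that makes the bound equal to the square of
  the right side.
\<close>

lemma L2norm_triangle:
  assumes v: "v \<in> L2space S" and w: "w \<in> L2space S"
  shows "L2norm S (\<lambda>x. v x + w x) \<le> L2norm S v + L2norm S w"
proof -
  let ?A = "L2norm S v" and ?B = "L2norm S w" and ?C = "L2norm S (\<lambda>x. v x + w x)"
  have C: "?C\<^sup>2 \<le> (1 + r) * ?A\<^sup>2 + (1 + 1 / r) * ?B\<^sup>2" if "r > 0" for r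
  proof -
    have "?C\<^sup>2 \<le> (\<integral>x. (1 + r) * (norm (v x))\<^sup>2 + (1 + 1 / r) * (norm (w x))\<^sup>2 \<partial>lebesgue_on S)"
      unfolding L2norm_square
      using v w L2space_add[OF v w] norm_add_square_weighted[OF that]
      by (intro integral_mono) (auto simp: L2space_def)
    also have "\<dots> = (1 + r) * ?A\<^sup>2 + (1 + 1 / r) * ?B\<^sup>2"
      using v w by (simp add: L2norm_square L2space_def)
    finally show ?thesis .
  qed
  have "?C \<le> ?A + ?B + e" if "e > 0" for e
  proof -
    \<comment> \<open>perturbing both norms by \<open>e / 2\<close> makes the optimal weight well defined\<close>
    define a b where "a = ?A + e / 2" and "b = ?B + e / 2"
    have ab: "a > 0" "b > 0" "?A \<le> a" "?B \<le> b"
      using L2norm_nonneg[of S v] L2norm_nonneg[of S w] that by (auto simp: a_def b_def)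
    have "?C\<^sup>2 \<le> (1 + b / a) * ?A\<^sup>2 + (1 + 1 / (b / a)) * ?B\<^sup>2"
      using C[of "b / a"] ab by simp
    also have "\<dots> \<le> (1 + b / a) * a\<^sup>2 + (1 + 1 / (b / a)) * b\<^sup>2"
      using ab L2norm_nonneg[of S v] L2norm_nonneg[of S w]
      by (intro add_mono mult_left_mono power_mono) auto
    also have "\<dots> = (a + b)\<^sup>2"
    proof -
      have "b / a * a\<^sup>2 = a * b" "1 / (b / a) * b\<^sup>2 = a * b"
        using ab by (simp_all add: power2_eq_square)
      then show ?thesis by (simp only: distrib_right power2_sum)
    qed
    finally have "?C\<^sup>2 \<le> (a + b)\<^sup>2" .
    then have "?C \<le> a + b"
      by (rule power2_le_imp_le) (use ab in linarith)
    then show ?thesis by (simp add: a_def b_def)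
  qed
  then show ?thesis by (rule field_le_epsilon)
qed

lemma L2space_continuous:
  fixes v :: "'a::euclidean_space \<Rightarrow> complex"
  assumes S: "compact S" and v: "continuous_on S v"
  shows "v \<in> L2space S"
proof -
  have "S \<in> sets lebesgue" using S by (simp add: lmeasurable_compact fmeasurableD)
  then have m[measurable]: "v \<in> borel_measurable (lebesgue_on S)"
    using v by (simp add: continuous_imp_measurable_on_sets_lebesgue)
  have "integrable lborel (\<lambda>x. indicator S x *\<^sub>R (norm (v x))\<^sup>2)"
    using S v by (intro borel_integrable_compact continuous_intros)
  then have "integrable lebesgue (\<lambda>x. indicator S x *\<^sub>R (norm (v x))\<^sup>2)"
    by (subst integrable_completion) auto
  then have "integrable (lebesgue_on S) (\<lambda>x. (norm (v x))\<^sup>2)"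
    using \<open>S \<in> sets lebesgue\<close> by (subst integrable_restrict_space) auto
  then show ?thesis by (simp add: L2space_def)
qed

section \<open>Slices of square integrable functions on a product\<close>

lemma completion_ex_borel_measurable_complex:
  fixes f :: "'a \<Rightarrow> complex"
  assumes "f \<in> borel_measurable (completion M)"
  shows "\<exists>g\<in>borel_measurable M. AE x in M. f x = g x"
proof -
  obtain r where r: "r \<in> borel_measurable M" "AE x in M. Re (f x) = r x"
    using completion_ex_borel_measurable_real[of "\<lambda>x. Re (f x)" M] assms by auto
  obtain i where i: "i \<in> borel_measurable M" "AE x in M. Im (f x) = i x"
    using completion_ex_borel_measurable_real[of "\<lambda>x. Im (f x)" M] assms by auto
  show ?thesis
  proof
    show "(\<lambda>x. Complex (r x) (i x)) \<in> borel_measurable M"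
      using r i by (simp add: Complex_eq)
    show "AE x in M. f x = Complex (r x) (i x)"
      using r(2) i(2) by eventually_elim (simp add: complex_eq_iff)
  qed
qed

text \<open>
  The two orders of integration are related by exchanging the coordinates. The results on slices
  are therefore stated for the first coordinate as parameter and transferred by \<open>prod.swap\<close>.
\<close>

lemma lborel_distr_swap:
  "distr (lborel :: ('a::euclidean_space \<times> 'b::euclidean_space) measure) lborel prod.swap = lborel"
proof -
  have "distr (lborel \<Otimes>\<^sub>M lborel :: ('a \<times> 'b) measure) (lborel \<Otimes>\<^sub>M lborel) (\<lambda>(x, y). (y, x)) = lborel \<Otimes>\<^sub>M lborel"
    by (rule lborel_pair.distr_pair_swap[symmetric])
  moreover have "prod.swap = (\<lambda>(x :: 'a, y :: 'b). (y, x))" by auto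
  ultimately show ?thesis by (simp only: lborel_prod)
qed

lemma borel_measurable_swap: "(prod.swap :: 'a::euclidean_space \<times> 'b::euclidean_space \<Rightarrow> _) \<in> borel_measurable borel"
  by (intro borel_measurable_continuous_onI continuous_on_swap)

lemma AE_lebesgue_on_swap:
  fixes P :: "'a::euclidean_space \<times> 'b::euclidean_space \<Rightarrow> bool"
  assumes A: "A \<in> sets borel" and B: "B \<in> sets borel"
    and P: "AE z in lebesgue_on (A \<times> B). P z"
  shows "AE z in lebesgue_on (B \<times> A). P (prod.swap z)"
proof -
  have [simp]: "A \<times> B \<in> sets borel" "B \<times> A \<in> sets borel" using A B by (auto intro: borel_Times)
  have "AE z in lborel. z \<in> A \<times> B \<longrightarrow> P z"
    using P by (simp add: AE_restrict_space_iff AE_completion_iff)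
  then have "AE z in distr (lborel :: ('b \<times> 'a) measure) lborel prod.swap. z \<in> A \<times> B \<longrightarrow> P z"
    by (simp only: lborel_distr_swap)
  then have "AE z in (lborel :: ('b \<times> 'a) measure). prod.swap z \<in> A \<times> B \<longrightarrow> P (prod.swap z)"
    by (rule AE_distrD[rotated]) (simp add: borel_measurable_swap)
  then have "AE z in (lborel :: ('b \<times> 'a) measure). z \<in> B \<times> A \<longrightarrow> P (prod.swap z)"
    by (rule eventually_mono) auto
  then show ?thesis
    by (simp add: AE_restrict_space_iff AE_completion_iff)
qed

lemma AE_lebesgue_on_prod:
  fixes P :: "'a::euclidean_space \<times> 'b::euclidean_space \<Rightarrow> bool"
  assumes A: "A \<in> sets borel" and B: "B \<in> sets borel"
    and P: "AE z in lebesgue_on (A \<times> B). P z"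
  shows "AE x in lebesgue_on A. AE y in lebesgue_on B. P (x, y)"
proof -
  have [simp]: "A \<times> B \<in> sets borel" using A B by (auto intro: borel_Times)
  have "AE z in lborel \<Otimes>\<^sub>M lborel. z \<in> A \<times> B \<longrightarrow> P z"
    using P unfolding lborel_prod by (simp add: AE_restrict_space_iff AE_completion_iff)
  from lborel_pair.AE_pair[OF this] show ?thesis
    using A B by (auto simp: AE_restrict_space_iff AE_completion_iff elim!: eventually_mono)
qed

text \<open>
  Tonelli's theorem holds for functions measurable with respect to the product \<open>\<sigma>\<close>-algebra. The
  Lebesgue sets of the product are its completion, so almost every slice of a Lebesgue measurable
  function is a null modification of a slice of a Borel function.
\<close>

lemma lebesgue_prod_borel_representative:
  fixes f :: "'a::euclidean_space \<times> 'b::euclidean_space \<Rightarrow> complex"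
  assumes A: "A \<in> sets borel" and B: "B \<in> sets borel"
    and f: "f \<in> borel_measurable (lebesgue_on (A \<times> B))"
  obtains g where "g \<in> borel_measurable borel"
    "AE z in lebesgue_on (A \<times> B). f z = g z"
    "\<And>z. z \<notin> A \<times> B \<Longrightarrow> g z = 0"
proof -
  have AB: "A \<times> B \<in> sets borel" using A B by (metis borel_Times)
  have "(\<lambda>z. if z \<in> A \<times> B then f z else 0) \<in> borel_measurable lebesgue"
    using f AB by (subst borel_measurable_if) (auto)
  then obtain g where g: "g \<in> borel_measurable lborel"
    and eq: "AE z in lborel. (if z \<in> A \<times> B then f z else 0) = g z"
    using completion_ex_borel_measurable_complex by blast
  define h where "h = (\<lambda>z. if z \<in> A \<times> B then g z else 0)"
  have h: "h \<in> borel_measurable borel"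
    unfolding h_def using g AB by (auto intro!: measurable_If_set)
  have "AE z in lborel. z \<in> A \<times> B \<longrightarrow> f z = h z"
    using eq by eventually_elim (auto simp: h_def)
  then have "AE z in lebesgue_on (A \<times> B). f z = h z"
    using AB by (subst AE_restrict_space_iff) (auto intro: AE_completion)
  then show ?thesis
    using that[OF h] by (auto simp: h_def)
qed

lemma nn_integral_lebesgue_on_borel:
  assumes "S \<in> sets borel"
  shows "(\<integral>\<^sup>+x. f x \<partial>lebesgue_on S) = (\<integral>\<^sup>+x. f x * indicator S x \<partial>lborel)"
  using assms by (simp add: nn_integral_restrict_space nn_integral_completion)

lemma tonelli_square_lebesgue_on:
  fixes f :: "'a::euclidean_space \<times> 'b::euclidean_space \<Rightarrow> complex"
  assumes A: "A \<in> sets borel" and B: "B \<in> sets borel"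
    and f: "f \<in> borel_measurable (lebesgue_on (A \<times> B))"
  shows "AE x in lebesgue_on A. (\<lambda>y. f (x, y)) \<in> borel_measurable (lebesgue_on B)"
    and "(\<lambda>x. \<integral>\<^sup>+y. ennreal ((norm (f (x, y)))\<^sup>2) \<partial>lebesgue_on B) \<in> borel_measurable (lebesgue_on A)"
    and "(\<integral>\<^sup>+x. \<integral>\<^sup>+y. ennreal ((norm (f (x, y)))\<^sup>2) \<partial>lebesgue_on B \<partial>lebesgue_on A)
           = (\<integral>\<^sup>+z. ennreal ((norm (f z))\<^sup>2) \<partial>lebesgue_on (A \<times> B))"
proof -
  have AB: "A \<times> B \<in> sets borel" using A B by (metis borel_Times)
  obtain g where g[measurable]: "g \<in> borel_measurable borel"
    and eq: "AE z in lebesgue_on (A \<times> B). f z = g z"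
    and g0: "\<And>z. z \<notin> A \<times> B \<Longrightarrow> g z = 0"
    using lebesgue_prod_borel_representative[OF A B f] by blast
  note eq2 = AE_lebesgue_on_prod[OF A B eq]
  have gs: "(\<lambda>y. g (x, y)) \<in> borel_measurable borel" for x
    by measurable
  have gs': "(\<lambda>y. g (x, y)) \<in> borel_measurable (lebesgue_on B)" for x
    using gs[of x] by (intro measurable_restrict_space1 measurable_completion) simp
  show "AE x in lebesgue_on A. (\<lambda>y. f (x, y)) \<in> borel_measurable (lebesgue_on B)"
    using eq2
  proof eventually_elim
    fix x assume "AE y in lebesgue_on B. f (x, y) = g (x, y)"
    then show "(\<lambda>y. f (x, y)) \<in> borel_measurable (lebesgue_on B)"
      using borel_measurable_lebesgue_on_cong_AE[OF _ gs'[of x]] B by (auto simp: eq_commute)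
  qed
  define q where "q x = (\<integral>\<^sup>+y. ennreal ((norm (f (x, y)))\<^sup>2) \<partial>lebesgue_on B)" for x
  define r where "r x = (\<integral>\<^sup>+y. ennreal ((norm (g (x, y)))\<^sup>2) \<partial>lborel)" for x
  have r': "r x = (\<integral>\<^sup>+y. ennreal ((norm (g (x, y)))\<^sup>2) \<partial>lebesgue_on B)" for x
    unfolding r_def nn_integral_lebesgue_on_borel[OF B] using g0[of "(x, _)"]
    by (intro nn_integral_cong) (auto simp: indicator_def)
  have qr: "AE x in lebesgue_on A. r x = q x"
    using eq2
  proof eventually_elim
    fix x assume "AE y in lebesgue_on B. f (x, y) = g (x, y)"
    then show "r x = q x"
      unfolding r' q_def by (intro nn_integral_cong_AE) (auto elim!: eventually_mono)
  qed
  have g2: "(\<lambda>z. ennreal ((norm (g z))\<^sup>2)) \<in> borel_measurable (lborel \<Otimes>\<^sub>M lborel)"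
    unfolding lborel_prod by measurable
  have "r \<in> borel_measurable lborel"
    using lborel.borel_measurable_nn_integral_fst[OF g2] by (simp add: r_def[abs_def])
  then have "r \<in> borel_measurable (lebesgue_on A)"
    by (intro measurable_restrict_space1 measurable_completion) simp
  then have "q \<in> borel_measurable (lebesgue_on A)"
    using borel_measurable_lebesgue_on_cong_AE[OF _ _ qr] A by simp
  then show "(\<lambda>x. \<integral>\<^sup>+y. ennreal ((norm (f (x, y)))\<^sup>2) \<partial>lebesgue_on B) \<in> borel_measurable (lebesgue_on A)"
    by (simp add: q_def[abs_def])
  have "(\<integral>\<^sup>+x. q x \<partial>lebesgue_on A) = (\<integral>\<^sup>+x. r x \<partial>lebesgue_on A)"
    using qr by (intro nn_integral_cong_AE) (auto elim!: eventually_mono)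
  also have "\<dots> = (\<integral>\<^sup>+x. r x \<partial>lborel)"
    unfolding nn_integral_lebesgue_on_borel[OF A] using g0[of "(_, _)"]
    by (intro nn_integral_cong) (auto simp: indicator_def r_def)
  also have "\<dots> = (\<integral>\<^sup>+z. ennreal ((norm (g z))\<^sup>2) \<partial>lborel)"
    using lborel.nn_integral_fst[OF g2] by (simp add: r_def lborel_prod)
  also have "\<dots> = (\<integral>\<^sup>+z. ennreal ((norm (g z))\<^sup>2) \<partial>lebesgue_on (A \<times> B))"
    unfolding nn_integral_lebesgue_on_borel[OF AB] using g0
    by (intro nn_integral_cong) (auto simp: indicator_def)
  also have "\<dots> = (\<integral>\<^sup>+z. ennreal ((norm (f z))\<^sup>2) \<partial>lebesgue_on (A \<times> B))"
    using eq by (intro nn_integral_cong_AE) (auto elim!: eventually_mono)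
  finally show "(\<integral>\<^sup>+x. \<integral>\<^sup>+y. ennreal ((norm (f (x, y)))\<^sup>2) \<partial>lebesgue_on B \<partial>lebesgue_on A)
           = (\<integral>\<^sup>+z. ennreal ((norm (f z))\<^sup>2) \<partial>lebesgue_on (A \<times> B))"
    by (simp add: q_def)
qed

lemma L2space_slices:
  fixes f :: "'a::euclidean_space \<times> 'b::euclidean_space \<Rightarrow> complex"
  assumes A: "A \<in> sets borel" and B: "B \<in> sets borel" and f: "f \<in> L2space (A \<times> B)"
  shows "AE x in lebesgue_on A. (\<lambda>y. f (x, y)) \<in> L2space B"
    and "integrable (lebesgue_on A) (\<lambda>x. (L2norm B (\<lambda>y. f (x, y)))\<^sup>2)"
    and "(\<integral>x. (L2norm B (\<lambda>y. f (x, y)))\<^sup>2 \<partial>lebesgue_on A) = (L2norm (A \<times> B) f)\<^sup>2"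
proof -
  have fm: "f \<in> borel_measurable (lebesgue_on (A \<times> B))" using f by (simp add: L2space_def)
  note T = tonelli_square_lebesgue_on[OF A B fm]
  define q where "q x = (\<integral>\<^sup>+y. ennreal ((norm (f (x, y)))\<^sup>2) \<partial>lebesgue_on B)" for x
  have q[measurable]: "q \<in> borel_measurable (lebesgue_on A)"
    using T(2) by (simp add: q_def[abs_def])
  have int: "(\<integral>\<^sup>+x. q x \<partial>lebesgue_on A) = ennreal ((L2norm (A \<times> B) f)\<^sup>2)"
    using T(3) nn_integral_eq_L2norm[OF f] by (simp add: q_def)
  have "AE x in lebesgue_on A. q x \<noteq> \<infinity>"
    using int by (intro nn_integral_PInf_AE) auto
  with T(1) show sl: "AE x in lebesgue_on A. (\<lambda>y. f (x, y)) \<in> L2space B"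
    by eventually_elim (auto simp: L2space_iff_nn_integral q_def less_top)
  have qn: "AE x in lebesgue_on A. q x = ennreal ((L2norm B (\<lambda>y. f (x, y)))\<^sup>2)"
    using sl by eventually_elim (simp add: q_def nn_integral_eq_L2norm)
  then have qe: "AE x in lebesgue_on A. enn2real (q x) = (L2norm B (\<lambda>y. f (x, y)))\<^sup>2"
    by eventually_elim simp
  have m: "(\<lambda>x. (L2norm B (\<lambda>y. f (x, y)))\<^sup>2) \<in> borel_measurable (lebesgue_on A)"
  proof (rule borel_measurable_lebesgue_on_cong_AE[OF _ _ qe])
    show "A \<in> sets lebesgue" using A by simp
    show "(\<lambda>x. enn2real (q x)) \<in> borel_measurable (lebesgue_on A)" by measurable
  qed
  have nn: "(\<integral>\<^sup>+x. ennreal ((L2norm B (\<lambda>y. f (x, y)))\<^sup>2) \<partial>lebesgue_on A) = ennreal ((L2norm (A \<times> B) f)\<^sup>2)"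
    unfolding int[symmetric] using qn by (intro nn_integral_cong_AE) (auto elim!: eventually_mono)
  show "integrable (lebesgue_on A) (\<lambda>x. (L2norm B (\<lambda>y. f (x, y)))\<^sup>2)"
    using m nn by (intro integrableI_bounded) auto
  show "(\<integral>x. (L2norm B (\<lambda>y. f (x, y)))\<^sup>2 \<partial>lebesgue_on A) = (L2norm (A \<times> B) f)\<^sup>2"
    using m nn by (subst integral_eq_nn_integral) auto
qed

text \<open>
  Turns a norm bound for an operator that acts slice by slice into a bound on the product.
\<close>

lemma L2space_from_slices:
  fixes f :: "'a::euclidean_space \<times> 'b::euclidean_space \<Rightarrow> complex"
  assumes A: "A \<in> sets borel" and B: "B \<in> sets borel"
    and f: "f \<in> borel_measurable (lebesgue_on (A \<times> B))"
    and h: "h \<in> L2space (A \<times> B)" and K: "K \<ge> 0"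
    and le: "AE x in lebesgue_on A. (\<lambda>y. f (x, y)) \<in> L2space B \<and>
               L2norm B (\<lambda>y. f (x, y)) \<le> K * L2norm B (\<lambda>y. h (x, y))"
  shows "f \<in> L2space (A \<times> B)" "L2norm (A \<times> B) f \<le> K * L2norm (A \<times> B) h"
proof -
  note T = tonelli_square_lebesgue_on[OF A B f]
  note H = L2space_slices[OF A B h]
  have "(\<integral>\<^sup>+z. ennreal ((norm (f z))\<^sup>2) \<partial>lebesgue_on (A \<times> B)) =
      (\<integral>\<^sup>+x. \<integral>\<^sup>+y. ennreal ((norm (f (x, y)))\<^sup>2) \<partial>lebesgue_on B \<partial>lebesgue_on A)"
    using T(3) by simp
  also have "\<dots> \<le> (\<integral>\<^sup>+x. ennreal (K\<^sup>2 * (L2norm B (\<lambda>y. h (x, y)))\<^sup>2) \<partial>lebesgue_on A)"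
  proof (intro nn_integral_mono_AE)
    show "AE x in lebesgue_on A. (\<integral>\<^sup>+y. ennreal ((norm (f (x, y)))\<^sup>2) \<partial>lebesgue_on B)
        \<le> ennreal (K\<^sup>2 * (L2norm B (\<lambda>y. h (x, y)))\<^sup>2)"
      using le
    proof eventually_elim
      case (elim x)
      then have "(L2norm B (\<lambda>y. f (x, y)))\<^sup>2 \<le> (K * L2norm B (\<lambda>y. h (x, y)))\<^sup>2"
        by (intro power_mono) (auto simp: L2norm_nonneg)
      then show ?case
        using elim by (subst nn_integral_eq_L2norm) (auto simp: power_mult_distrib intro!: ennreal_leI)
    qed
  qed
  also have "\<dots> = ennreal (K\<^sup>2 * (L2norm (A \<times> B) h)\<^sup>2)"
    using H(2,3) by (subst nn_integral_eq_integral) auto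
  finally have *: "(\<integral>\<^sup>+z. ennreal ((norm (f z))\<^sup>2) \<partial>lebesgue_on (A \<times> B)) \<le> ennreal (K\<^sup>2 * (L2norm (A \<times> B) h)\<^sup>2)" .
  then show f2: "f \<in> L2space (A \<times> B)"
    unfolding L2space_iff_nn_integral using f le_less_trans[OF *] by simp
  have "(L2norm (A \<times> B) f)\<^sup>2 \<le> (K * L2norm (A \<times> B) h)\<^sup>2"
    using * unfolding nn_integral_eq_L2norm[OF f2] by (simp add: power_mult_distrib)
  then show "L2norm (A \<times> B) f \<le> K * L2norm (A \<times> B) h"
    using K by (rule_tac power2_le_imp_le) (auto simp: L2norm_nonneg)
qed

lemma L2space_swap:
  fixes f :: "'a::euclidean_space \<times> 'b::euclidean_space \<Rightarrow> complex"
  assumes A: "A \<in> sets borel" and B: "B \<in> sets borel"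
  shows "f \<in> borel_measurable (lebesgue_on (A \<times> B)) \<Longrightarrow> f \<circ> prod.swap \<in> borel_measurable (lebesgue_on (B \<times> A))"
    and "f \<in> L2space (A \<times> B) \<Longrightarrow> f \<circ> prod.swap \<in> L2space (B \<times> A)"
    and "f \<in> L2space (A \<times> B) \<Longrightarrow> L2norm (B \<times> A) (f \<circ> prod.swap) = L2norm (A \<times> B) f"
proof -
  have AB: "A \<times> B \<in> sets borel" and BA: "B \<times> A \<in> sets borel" using A B by (auto intro: borel_Times)
  have *: "f \<circ> prod.swap \<in> borel_measurable (lebesgue_on (B \<times> A)) \<and>
     (\<integral>\<^sup>+z. ennreal ((norm ((f \<circ> prod.swap) z))\<^sup>2) \<partial>lebesgue_on (B \<times> A)) =
     (\<integral>\<^sup>+z. ennreal ((norm (f z))\<^sup>2) \<partial>lebesgue_on (A \<times> B))"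
    if f: "f \<in> borel_measurable (lebesgue_on (A \<times> B))"
  proof
    obtain g where g[measurable]: "g \<in> borel_measurable borel"
      and eq: "AE z in lebesgue_on (A \<times> B). f z = g z"
      and g0: "\<And>z. z \<notin> A \<times> B \<Longrightarrow> g z = 0"
      using lebesgue_prod_borel_representative[OF A B f] by blast
    note eqs = AE_lebesgue_on_swap[OF A B eq]
    have [measurable]: "g \<circ> prod.swap \<in> borel_measurable borel"
      using measurable_comp[OF borel_measurable_swap g] .
    then have "g \<circ> prod.swap \<in> borel_measurable (lebesgue_on (B \<times> A))"
      by (intro measurable_restrict_space1 measurable_completion) simp
    then show "f \<circ> prod.swap \<in> borel_measurable (lebesgue_on (B \<times> A))"
      by (rule borel_measurable_lebesgue_on_cong_AE[rotated]) (use BA eqs in \<open>auto simp: eq_commute\<close>)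
    have "(\<integral>\<^sup>+z. ennreal ((norm ((f \<circ> prod.swap) z))\<^sup>2) \<partial>lebesgue_on (B \<times> A))
        = (\<integral>\<^sup>+z. ennreal ((norm (g (prod.swap z)))\<^sup>2) \<partial>lebesgue_on (B \<times> A))"
      using eqs by (intro nn_integral_cong_AE) (auto elim!: eventually_mono)
    also have "\<dots> = (\<integral>\<^sup>+z. ennreal ((norm (g (prod.swap z)))\<^sup>2) \<partial>lborel)"
    proof -
      have "g (prod.swap z) = 0" if "z \<notin> B \<times> A" for z
        using g0[of "prod.swap z"] that by (cases z) auto
      then show ?thesis
        unfolding nn_integral_lebesgue_on_borel[OF BA]
        by (intro nn_integral_cong) (auto simp: indicator_def simp del: swap_simp)
    qed
    also have "\<dots> = (\<integral>\<^sup>+z. ennreal ((norm (g z))\<^sup>2) \<partial>distr lborel lborel prod.swap)"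
      by (subst nn_integral_distr) (auto simp: borel_measurable_swap)
    also have "\<dots> = (\<integral>\<^sup>+z. ennreal ((norm (g z))\<^sup>2) \<partial>lborel)"
      by (simp only: lborel_distr_swap)
    also have "\<dots> = (\<integral>\<^sup>+z. ennreal ((norm (g z))\<^sup>2) \<partial>lebesgue_on (A \<times> B))"
      unfolding nn_integral_lebesgue_on_borel[OF AB] using g0
      by (intro nn_integral_cong) (auto simp: indicator_def)
    also have "\<dots> = (\<integral>\<^sup>+z. ennreal ((norm (f z))\<^sup>2) \<partial>lebesgue_on (A \<times> B))"
      using eq by (intro nn_integral_cong_AE) (auto elim!: eventually_mono)
    finally show "(\<integral>\<^sup>+z. ennreal ((norm ((f \<circ> prod.swap) z))\<^sup>2) \<partial>lebesgue_on (B \<times> A)) =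
        (\<integral>\<^sup>+z. ennreal ((norm (f z))\<^sup>2) \<partial>lebesgue_on (A \<times> B))" .
  qed
  then show "f \<in> borel_measurable (lebesgue_on (A \<times> B)) \<Longrightarrow> f \<circ> prod.swap \<in> borel_measurable (lebesgue_on (B \<times> A))"
    by blast
  show 2: "f \<circ> prod.swap \<in> L2space (B \<times> A)" if "f \<in> L2space (A \<times> B)"
    using * that unfolding L2space_iff_nn_integral by simp
  show "L2norm (B \<times> A) (f \<circ> prod.swap) = L2norm (A \<times> B) f" if "f \<in> L2space (A \<times> B)"
  proof -
    have "ennreal ((L2norm (B \<times> A) (f \<circ> prod.swap))\<^sup>2) = ennreal ((L2norm (A \<times> B) f)\<^sup>2)"
      using * that nn_integral_eq_L2norm[OF that] nn_integral_eq_L2norm[OF 2[OF that]]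
      by (simp add: L2space_def)
    then show ?thesis by (simp add: L2norm_nonneg)
  qed
qed

section \<open>Bounded functionals applied to slices\<close>

definition L2_functional :: "'a::euclidean_space set \<Rightarrow> (('a \<Rightarrow> complex) \<Rightarrow> complex) \<Rightarrow> bool" where
  "L2_functional S \<phi> \<longleftrightarrow>
     (\<forall>v\<in>L2space S. \<forall>w\<in>L2space S. \<phi> (\<lambda>x. v x + w x) = \<phi> v + \<phi> w) \<and>
     (\<forall>v\<in>L2space S. \<forall>a. \<phi> (\<lambda>x. a * v x) = a * \<phi> v) \<and>
     (\<exists>C. \<forall>v\<in>L2space S. norm (\<phi> v) \<le> C * L2norm S v)"

lemma L2_functional_add:
  "L2_functional S \<phi> \<Longrightarrow> v \<in> L2space S \<Longrightarrow> w \<in> L2space S \<Longrightarrow> \<phi> (\<lambda>x. v x + w x) = \<phi> v + \<phi> w"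
  by (simp add: L2_functional_def)

lemma L2_functional_mult:
  "L2_functional S \<phi> \<Longrightarrow> v \<in> L2space S \<Longrightarrow> \<phi> (\<lambda>x. a * v x) = a * \<phi> v"
  by (simp add: L2_functional_def)

lemma L2_functional_bound:
  assumes "L2_functional S \<phi>"
  obtains C where "\<And>v. v \<in> L2space S \<Longrightarrow> norm (\<phi> v) \<le> C * L2norm S v"
  using assms unfolding L2_functional_def by blast

lemma L2_functional_zero:
  assumes "L2_functional S \<phi>" shows "\<phi> (\<lambda>x. 0) = 0"
  using L2_functional_mult[OF assms L2space_zero, of 0] by simp

lemma L2_functional_diff:
  assumes "L2_functional S \<phi>" "v \<in> L2space S" "w \<in> L2space S"
  shows "\<phi> (\<lambda>x. v x - w x) = \<phi> v - \<phi> w"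
  using L2_functional_add[OF assms(1,2) L2space_mult[OF assms(3), of "-1"]]
    L2_functional_mult[OF assms(1,3), of "-1"] by simp

lemma L2_functional_sum:
  assumes "L2_functional S \<phi>" "\<And>i. i \<in> I \<Longrightarrow> v i \<in> L2space S"
  shows "\<phi> (\<lambda>x. \<Sum>i\<in>I. v i x) = (\<Sum>i\<in>I. \<phi> (v i))"
  using assms(2)
  by (induction I rule: infinite_finite_induct)
     (auto simp: L2_functional_zero[OF assms(1)] L2_functional_add[OF assms(1)] L2space_sum)

text \<open>
  Boundedness makes the functional blind to null sets, because the norm of the difference vanishes.
\<close>

lemma L2_functional_cong_AE:
  assumes \<phi>: "L2_functional S \<phi>" and S: "S \<in> sets lebesgue" and v: "v \<in> L2space S"
    and eq: "AE x in lebesgue_on S. v x = w x"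
  shows "\<phi> v = \<phi> w"
proof -
  have w: "w \<in> L2space S" using L2space_cong_AE(1)[OF S v eq] .
  have "AE x in lebesgue_on S. (\<lambda>x. 0) x = v x - w x" using eq by eventually_elim simp
  then have "L2norm S (\<lambda>x. v x - w x) = 0"
    using L2space_cong_AE(2)[OF S L2space_zero] by (simp add: L2norm_def)
  moreover obtain C where "\<And>u. u \<in> L2space S \<Longrightarrow> norm (\<phi> u) \<le> C * L2norm S u"
    using L2_functional_bound[OF \<phi>] by blast
  ultimately have "norm (\<phi> (\<lambda>x. v x - w x)) \<le> 0"
    using L2space_diff[OF v w] by fastforce
  then show ?thesis by (simp add: L2_functional_diff[OF \<phi> v w])
qed

lemma L2_functional_dominated_convergence:
  fixes v :: "nat \<Rightarrow> 'a::euclidean_space \<Rightarrow> complex"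
  assumes \<phi>: "L2_functional S \<phi>"
    and v: "\<And>n. v n \<in> borel_measurable (lebesgue_on S)" and u: "u \<in> borel_measurable (lebesgue_on S)"
    and w: "w \<in> L2space S"
    and lim: "\<And>x. x \<in> S \<Longrightarrow> (\<lambda>n. v n x) \<longlonglongrightarrow> u x"
    and bound: "\<And>n x. x \<in> S \<Longrightarrow> norm (v n x) \<le> norm (w x)"
  shows "(\<lambda>n. \<phi> (v n)) \<longlonglongrightarrow> \<phi> u"
proof -
  note [measurable] = v u
  have v2: "v n \<in> L2space S" for n
    by (rule L2space_bound[OF v w]) (auto intro!: AE_I2 bound)
  have u_bound: "norm (u x) \<le> norm (w x)" if "x \<in> S" for x
    by (rule LIMSEQ_le_const2[OF tendsto_norm[OF lim[OF that]]]) (use bound that in auto)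
  then have u2: "u \<in> L2space S"
    by (intro L2space_bound[OF u w]) (auto intro!: AE_I2)
  have "(\<lambda>n. \<integral>x. (norm (v n x - u x))\<^sup>2 \<partial>lebesgue_on S) \<longlonglongrightarrow> (\<integral>x. 0 \<partial>lebesgue_on S)"
  proof (rule integral_dominated_convergence)
    show "integrable (lebesgue_on S) (\<lambda>x. 4 * (norm (w x))\<^sup>2)"
      using w by (simp add: L2space_def)
    show "AE x in lebesgue_on S. (\<lambda>n. (norm (v n x - u x))\<^sup>2) \<longlonglongrightarrow> 0"
    proof (rule AE_I2)
      fix x assume "x \<in> space (lebesgue_on S)"
      then have "(\<lambda>n. v n x - u x) \<longlonglongrightarrow> 0"
        using lim[of x] by (simp add: LIM_zero)
      then show "(\<lambda>n. (norm (v n x - u x))\<^sup>2) \<longlonglongrightarrow> 0"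
        by (metis power_zero_numeral tendsto_norm_zero tendsto_power)
    qed
    show "AE x in lebesgue_on S. norm ((norm (v n x - u x))\<^sup>2) \<le> 4 * (norm (w x))\<^sup>2" for n
    proof (rule AE_I2)
      fix x assume "x \<in> space (lebesgue_on S)"
      then have "norm (v n x - u x) \<le> 2 * norm (w x)"
        using bound[of x n] u_bound[of x] norm_triangle_ineq4[of "v n x" "u x"] by simp
      then have "(norm (v n x - u x))\<^sup>2 \<le> (2 * norm (w x))\<^sup>2"
        by (rule power_mono) simp
      then show "norm ((norm (v n x - u x))\<^sup>2) \<le> 4 * (norm (w x))\<^sup>2"
        by (simp add: power_mult_distrib)
    qed
  qed measurable
  then have "(\<lambda>n. L2norm S (\<lambda>x. v n x - u x)) \<longlonglongrightarrow> 0"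
    unfolding L2norm_def using tendsto_real_sqrt by fastforce
  moreover obtain C where C: "\<And>u. u \<in> L2space S \<Longrightarrow> norm (\<phi> u) \<le> C * L2norm S u"
    using L2_functional_bound[OF \<phi>] by blast
  ultimately have lim0: "(\<lambda>n. C * L2norm S (\<lambda>x. v n x - u x)) \<longlonglongrightarrow> 0"
    by (simp add: tendsto_mult_right_zero)
  have "norm (\<phi> (v n) - \<phi> u) \<le> C * L2norm S (\<lambda>x. v n x - u x)" for n
    using C[OF L2space_diff[OF v2[of n] u2]] by (simp add: L2_functional_diff[OF \<phi> v2 u2])
  then have "(\<lambda>n. \<phi> (v n) - \<phi> u) \<longlonglongrightarrow> 0"
    by (rule Lim_null_comparison[OF always_eventually[OF allI] lim0])
  then show ?thesis by (rule LIM_zero_cancel)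
qed

text \<open>
  Rectangles \<open>A \<times> B\<close> give \<open>indicator A x * \<phi> (indicator B)\<close>, and bounded convergence in
  \<open>L\<^sup>2(S)\<close> makes the sets with the property a Dynkin system.
\<close>

lemma L2_functional_slice_indicator_measurable:
  fixes S :: "'b::euclidean_space set" and E :: "('a::euclidean_space \<times> 'b) set"
  assumes \<phi>: "L2_functional S \<phi>" and S: "compact S" and E: "E \<in> sets borel"
  shows "(\<lambda>x. \<phi> (\<lambda>y. indicator E (x, y))) \<in> borel_measurable borel"
proof -
  have meas: "(\<lambda>y. indicator F (x, y) :: complex) \<in> borel_measurable (lebesgue_on S)"
    if [measurable]: "F \<in> sets borel" for F and x :: 'a
  proof -
    have "(\<lambda>y. indicator F (x, y) :: complex) \<in> borel_measurable borel"
      by measurable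
    then show ?thesis
      by (intro measurable_restrict_space1 measurable_completion) simp
  qed
  have one: "(\<lambda>y. 1) \<in> L2space S"
    using S by (intro L2space_continuous) auto
  have ind: "(\<lambda>y. indicator F (x, y) :: complex) \<in> L2space S" if "F \<in> sets borel" for F and x :: 'a
    by (rule L2space_bound[OF meas[OF that] one]) (auto simp: indicator_def)
  have gen: "sets (borel :: ('a \<times> 'b) measure) = sigma_sets (UNIV \<times> UNIV) {A \<times> B | A B. A \<in> sets borel \<and> B \<in> sets borel}"
    using sets_pair_measure[of "borel :: 'a measure" "borel :: 'b measure"] by (simp only: borel_prod space_borel)
  have E': "E \<in> sigma_sets (UNIV \<times> UNIV) {A \<times> B | A B. A \<in> sets (borel :: 'a measure) \<and> B \<in> sets (borel :: 'b measure)}"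
    using E gen by simp
  have "Int_stable {A \<times> B | A B. A \<in> sets (borel :: 'a measure) \<and> B \<in> sets (borel :: 'b measure)}"
    by (rule Int_stable_pair_measure_generator)
  moreover have "{A \<times> B | A B. A \<in> sets (borel :: 'a measure) \<and> B \<in> sets (borel :: 'b measure)} \<subseteq> Pow (UNIV \<times> UNIV)"
    by auto
  ultimately show ?thesis using E'
  proof (induction rule: sigma_sets_induct_disjoint)
    case (basic F)
    then obtain A B where F: "F = A \<times> B" "A \<in> sets borel" "B \<in> sets borel" by auto
    have B: "(\<lambda>y. indicator B y :: complex) \<in> L2space S"
      using ind[of "UNIV \<times> B" undefined] F(3) by (simp add: indicator_def borel_Times)
    have "(\<lambda>x. \<phi> (\<lambda>y. indicator F (x, y))) = (\<lambda>x. indicator A x * \<phi> (indicator B))"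
      using L2_functional_mult[OF \<phi> B] by (auto simp: F indicator_times)
    then show ?case using F by simp
  next
    case empty
    then show ?case by (simp add: L2_functional_zero[OF \<phi>])
  next
    case (compl F)
    have F: "F \<in> sets borel" using compl(1) gen by simp
    have "(\<lambda>x. \<phi> (\<lambda>y. indicator (UNIV \<times> UNIV - F) (x, y))) = (\<lambda>x. \<phi> (\<lambda>y. 1) - \<phi> (\<lambda>y. indicator F (x, y)))"
    proof
      fix x
      have "(\<lambda>y. indicator (UNIV \<times> UNIV - F) (x, y) :: complex) = (\<lambda>y. 1 - indicator F (x, y))"
        by (auto simp: indicator_def)
      then show "\<phi> (\<lambda>y. indicator (UNIV \<times> UNIV - F) (x, y)) = \<phi> (\<lambda>y. 1) - \<phi> (\<lambda>y. indicator F (x, y))"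
        using L2_functional_diff[OF \<phi> one ind[OF F, of x]] by simp
    qed
    then show ?case using compl by simp
  next
    case (union F)
    have F: "F i \<in> sets borel" for i using union(2) gen by auto
    have UF: "(\<Union>i. F i) \<in> sets borel" using F by auto
    have lim: "(\<lambda>n. \<Sum>i<n. indicator (F i) z :: complex) \<longlonglongrightarrow> indicator (\<Union>i. F i) z" for z
    proof -
      have "(\<lambda>i. indicator (F i) z :: real) sums indicator (\<Union>i. F i) z"
        using union(1) by (intro indicator_sums) (auto simp: disjoint_family_on_def)
      then have "(\<lambda>i. complex_of_real (indicator (F i) z)) sums complex_of_real (indicator (\<Union>i. F i) z)"
        by (rule sums_of_real)
      then show ?thesis by (simp add: sums_def of_real_indicator)
    qed
    have bound: "norm (\<Sum>i<n. indicator (F i) z :: complex) \<le> 1" for n z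
    proof -
      have "(\<Sum>i<n. indicator (F i) z :: complex) = indicator (\<Union>i<n. F i) z"
        using union(1) by (subst indicator_UN_disjoint) (auto simp: disjoint_family_on_def)
      then show ?thesis by (simp add: indicator_def)
    qed
    have "(\<lambda>n. \<phi> (\<lambda>y. \<Sum>i<n. indicator (F i) (x, y))) \<longlonglongrightarrow> \<phi> (\<lambda>y. indicator (\<Union>i. F i) (x, y))" for x
    proof (rule L2_functional_dominated_convergence[OF \<phi> _ _ one])
      show "(\<lambda>y. \<Sum>i<n. indicator (F i) (x, y) :: complex) \<in> borel_measurable (lebesgue_on S)" for n
        by (intro borel_measurable_sum meas F)
    qed (use meas[OF UF] lim bound in auto)
    then have "(\<lambda>n. \<Sum>i<n. \<phi> (\<lambda>y. indicator (F i) (x, y))) \<longlonglongrightarrow> \<phi> (\<lambda>y. indicator (\<Union>i. F i) (x, y))" for x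
      by (simp add: L2_functional_sum[OF \<phi> ind[OF F]])
    then show ?case
      by (rule borel_measurable_LIMSEQ_metric[rotated]) (intro borel_measurable_sum union(3))
  qed
qed

text \<open>
  Simple functions that approximate \<open>g\<close> pointwise and stay below \<open>2 * norm g\<close> converge in \<open>L\<^sup>2\<close> on
  every square integrable slice, by dominated convergence. The other slices form a measurable set,
  on which the value is set to 0.
\<close>

lemma L2_functional_slice_measurable_borel:
  fixes S :: "'b::euclidean_space set" and g :: "'a::euclidean_space \<times> 'b \<Rightarrow> complex"
  assumes \<phi>: "L2_functional S \<phi>" and S: "compact S" and g[measurable]: "g \<in> borel_measurable borel"
  shows "(\<lambda>x. if (\<lambda>y. g (x, y)) \<in> L2space S then \<phi> (\<lambda>y. g (x, y)) else 0) \<in> borel_measurable borel"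
proof -
  have S': "S \<in> sets borel" using S by (simp add: compact_imp_closed)
  obtain F where sf: "\<And>i. simple_function borel (F i)"
    and lim: "\<And>z. (\<lambda>i. F i z) \<longlonglongrightarrow> g z" and bound: "\<And>i z. norm (F i z) \<le> 2 * norm (g z)"
    using borel_measurable_implies_sequence_metric[OF g, of 0] by auto
  have [measurable]: "F i \<in> borel_measurable borel" for i
    using sf by (rule borel_measurable_simple_function)
  have slice: "(\<lambda>y. h (x, y)) \<in> borel_measurable (lebesgue_on S)" if [measurable]: "h \<in> borel_measurable borel"
    for h :: "'a \<times> 'b \<Rightarrow> complex" and x
    by (intro measurable_restrict_space1 measurable_completion) simp
  define G where "G = {x. (\<lambda>y. g (x, y)) \<in> L2space S}"
  have G: "G \<in> sets borel"
  proof -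
    have [measurable]: "snd \<in> (borel :: ('a \<times> 'b) measure) \<rightarrow>\<^sub>M borel"
      by (intro borel_measurable_continuous_onI continuous_intros)
    have "(\<lambda>z. ennreal ((norm (g z))\<^sup>2) * indicator S (snd z)) \<in> borel_measurable borel"
      using S' by measurable
    then have "(\<lambda>z. ennreal ((norm (g z))\<^sup>2) * indicator S (snd z)) \<in> borel_measurable (lborel \<Otimes>\<^sub>M lborel)"
      by (simp add: lborel_prod)
    from lborel.borel_measurable_nn_integral_fst[OF this]
    have [measurable]: "(\<lambda>x. \<integral>\<^sup>+y. ennreal ((norm (g (x, y)))\<^sup>2) * indicator S y \<partial>lborel) \<in> borel_measurable borel"
      by simp
    have "G = {x. (\<integral>\<^sup>+y. ennreal ((norm (g (x, y)))\<^sup>2) * indicator S y \<partial>lborel) < \<infinity>}"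
      unfolding G_def L2space_iff_nn_integral nn_integral_lebesgue_on_borel[OF S'] using slice[OF g] by auto
    also have "\<dots> \<in> sets borel" by measurable
    finally show ?thesis .
  qed
  have F: "(\<lambda>x. \<phi> (\<lambda>y. F i (x, y))) \<in> borel_measurable borel" for i
  proof -
    have fin: "finite (range (F i))" using sf[of i] by (simp add: simple_function_def)
    have vim: "F i -` {c} \<in> sets borel" for c
      using measurable_sets[of "F i" borel borel "{c}"] by simp
    have one: "(\<lambda>y. 1) \<in> L2space S" using S by (intro L2space_continuous) auto
    have ind: "(\<lambda>y. indicator (F i -` {c}) (x, y) :: complex) \<in> L2space S" for c x
      by (rule L2space_bound[OF slice one]) (use vim in \<open>auto simp: indicator_def\<close>)
    have rep: "F i z = (\<Sum>c\<in>range (F i). c * indicator (F i -` {c}) z)" for z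
      using fin by (simp add: indicator_def sum.delta[of _ "F i z" "\<lambda>c. c"] if_distrib[of "\<lambda>u. _ * u"] cong: if_cong)
    have "\<phi> (\<lambda>y. F i (x, y)) = (\<Sum>c\<in>range (F i). c * \<phi> (\<lambda>y. indicator (F i -` {c}) (x, y)))" for x
    proof -
      have "\<phi> (\<lambda>y. F i (x, y)) = \<phi> (\<lambda>y. \<Sum>c\<in>range (F i). c * indicator (F i -` {c}) (x, y))"
        by (rule arg_cong[where f=\<phi>], rule ext, rule rep)
      also have "\<dots> = (\<Sum>c\<in>range (F i). \<phi> (\<lambda>y. c * indicator (F i -` {c}) (x, y)))"
        by (rule L2_functional_sum[OF \<phi> L2space_mult[OF ind]])
      also have "\<dots> = (\<Sum>c\<in>range (F i). c * \<phi> (\<lambda>y. indicator (F i -` {c}) (x, y)))"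
        by (simp only: L2_functional_mult[OF \<phi> ind])
      finally show ?thesis .
    qed
    then show ?thesis
      using L2_functional_slice_indicator_measurable[OF \<phi> S vim] by (simp add: borel_measurable_sum)
  qed
  have "(\<lambda>x. if x \<in> G then \<phi> (\<lambda>y. g (x, y)) else 0) \<in> borel_measurable borel"
  proof (rule borel_measurable_LIMSEQ_metric)
    show "(\<lambda>x. if x \<in> G then \<phi> (\<lambda>y. F i (x, y)) else 0) \<in> borel_measurable borel" for i
      using F G by (intro measurable_If_set) auto
    show "(\<lambda>i. if x \<in> G then \<phi> (\<lambda>y. F i (x, y)) else 0) \<longlonglongrightarrow> (if x \<in> G then \<phi> (\<lambda>y. g (x, y)) else 0)" for x
    proof (cases "x \<in> G")
      case True
      have "(\<lambda>i. \<phi> (\<lambda>y. F i (x, y))) \<longlonglongrightarrow> \<phi> (\<lambda>y. g (x, y))"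
      proof (rule L2_functional_dominated_convergence[OF \<phi>])
        show "(\<lambda>y. 2 * g (x, y)) \<in> L2space S"
          using True by (intro L2space_mult) (simp add: G_def)
      qed (use lim bound in \<open>auto intro!: slice simp: norm_mult\<close>)
      then show ?thesis using True by simp
    qed simp
  qed
  then show ?thesis by (simp add: G_def)
qed

text \<open>
  Almost every slice of \<open>f\<close> differs from the slice of a Borel version by a null set, which \<open>\<phi>\<close>
  ignores. The lemma takes the place of a Riesz representation of \<open>\<phi>\<close>, from which measurability
  would follow by integrating against a kernel.
\<close>

lemma L2_functional_slice_measurable:
  fixes S :: "'b::euclidean_space set" and f :: "'a::euclidean_space \<times> 'b \<Rightarrow> complex"
  assumes \<phi>: "L2_functional S \<phi>" and S: "compact S" and A: "A \<in> sets borel"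
    and f: "f \<in> L2space (A \<times> S)"
  shows "(\<lambda>x. \<phi> (\<lambda>y. f (x, y))) \<in> borel_measurable (lebesgue_on A)"
proof -
  have S': "S \<in> sets borel" using S by (simp add: compact_imp_closed)
  have fm: "f \<in> borel_measurable (lebesgue_on (A \<times> S))" using f by (simp add: L2space_def)
  obtain g where g: "g \<in> borel_measurable borel"
    and eq: "AE z in lebesgue_on (A \<times> S). f z = g z"
    using lebesgue_prod_borel_representative[OF A S' fm] by blast
  let ?\<psi> = "\<lambda>x. if (\<lambda>y. g (x, y)) \<in> L2space S then \<phi> (\<lambda>y. g (x, y)) else 0"
  have "AE x in lebesgue_on A. ?\<psi> x = \<phi> (\<lambda>y. f (x, y))"
    using AE_lebesgue_on_prod[OF A S' eq] L2space_slices(1)[OF A S' f]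
  proof eventually_elim
    case (elim x)
    then show ?case
      using L2space_cong_AE(1)[of S "\<lambda>y. f (x, y)" "\<lambda>y. g (x, y)"]
        L2_functional_cong_AE[OF \<phi>, of "\<lambda>y. f (x, y)" "\<lambda>y. g (x, y)"] S' by auto
  qed
  then show ?thesis
  proof (rule borel_measurable_lebesgue_on_cong_AE[rotated 2])
    show "?\<psi> \<in> borel_measurable (lebesgue_on A)"
    using L2_functional_slice_measurable_borel[OF \<phi> S g]
    by (intro measurable_restrict_space1 measurable_completion) simp
  qed (use A in simp)
qed

section \<open>Trigonometric interpolation\<close>

lemma poly_lagrange_interpolation:
  fixes p :: "'a::field poly" and z :: "nat \<Rightarrow> 'a"
  assumes deg: "degree p \<le> n" and inj: "inj_on z {..n}"
  shows "poly p w = (\<Sum>j\<le>n. poly p (z j) * (\<Prod>k\<in>{..n} - {j}. (w - z k) / (z j - z k)))"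
proof -
  define b where "b j = (\<Prod>k\<in>{..n} - {j}. smult (1 / (z j - z k)) [:- z k, 1:])" for j
  define q where "q = (\<Sum>j\<le>n. smult (poly p (z j)) (b j))"
  have b: "poly (b j) w = (\<Prod>k\<in>{..n} - {j}. (w - z k) / (z j - z k))" for j w
    by (simp add: b_def poly_prod diff_divide_distrib)
  have "degree (b j) \<le> n" if "j \<le> n" for j
  proof -
    have "degree (b j) \<le> (\<Sum>k\<in>{..n} - {j}. degree (smult (1 / (z j - z k)) [:- z k, 1:]))"
      unfolding b_def by (rule order.trans[OF degree_prod_sum_le]) (simp_all add: o_def)
    also have "\<dots> \<le> (\<Sum>k\<in>{..n} - {j}. 1)"
      by (intro sum_mono) simp
    finally show ?thesis using that by simp
  qed
  then have "degree q \<le> n"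
    unfolding q_def by (intro degree_sum_le) (auto intro: order.trans[OF degree_smult_le])
  moreover have "poly q (z i) = poly p (z i)" if "i \<le> n" for i
  proof -
    have "poly (b j) (z i) = (if j = i then 1 else 0)" if "j \<le> n" for j
    proof (cases "j = i")
      case True
      then show ?thesis
        using inj \<open>i \<le> n\<close> by (auto simp: b inj_on_def intro!: prod.neutral split: if_splits)
    next
      case False
      then show ?thesis
        using \<open>i \<le> n\<close> by (auto simp: b intro!: prod_zero)
    qed
    then show ?thesis
      using that by (simp add: q_def poly_sum if_distrib[of "\<lambda>u. _ * u"] cong: if_cong)
  qed
  ultimately have "q = p"
    using deg inj by (intro poly_eqI_degree[of "z ` {..n}"]) (auto simp: card_image)
  then have "poly p w = poly q w" by simp
  then show ?thesis
    by (simp add: q_def poly_sum b)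
qed

text \<open>
  The Lagrange basis for the nodes \<open>exp (\<i> * s k)\<close> of the unit circle, shifted down by \<open>N\<close>
  frequencies so that it consists of trigonometric polynomials of degree at most \<open>N\<close>.
\<close>

definition trig_lagrange :: "nat \<Rightarrow> (nat \<Rightarrow> real) \<Rightarrow> nat \<Rightarrow> real \<Rightarrow> complex" where
  "trig_lagrange N s j t = exp (- (\<i> * of_nat N * of_real (t - s j))) *
     (\<Prod>k\<in>{..2 * N} - {j}. (exp (\<i> * of_real t) - exp (\<i> * of_real (s k))) /
                              (exp (\<i> * of_real (s j)) - exp (\<i> * of_real (s k))))"

lemma fourier_synth_as_poly:
  "exp (\<i> * of_nat N * of_real t) * fourier_synth N c t =
     poly (\<Sum>k\<le>2 * N. monom (c (int k - int N)) k) (exp (\<i> * of_real t))"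
proof -
  have bij: "bij_betw (\<lambda>k. int k - int N) {..2 * N} {- int N..int N}"
    by (rule bij_betw_byWitness[of _ "\<lambda>l. nat (l + int N)"]) auto
  have "fourier_synth N c t = (\<Sum>k\<le>2 * N. c (int k - int N) * exp (\<i> * of_int (int k - int N) * of_real t))"
    unfolding fourier_synth_def by (rule sum.reindex_bij_betw[OF bij, symmetric])
  then have "exp (\<i> * of_nat N * of_real t) * fourier_synth N c t =
      (\<Sum>k\<le>2 * N. c (int k - int N) *
         (exp (\<i> * of_nat N * of_real t) * exp (\<i> * of_int (int k - int N) * of_real t)))"
    by (simp add: sum_distrib_left ac_simps)
  also have "\<dots> = (\<Sum>k\<le>2 * N. c (int k - int N) * exp (\<i> * of_real t) ^ k)"
    by (intro sum.cong refl arg_cong2[where f="(*)"])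
       (simp add: exp_of_nat_mult[symmetric] exp_add[symmetric] algebra_simps)
  finally show ?thesis
    by (simp add: poly_sum poly_monom)
qed

text \<open>
  After multiplication by \<open>exp (\<i> * N * t)\<close> a trigonometric polynomial is an algebraic polynomial
  of degree at most \<open>2 * N\<close> in \<open>exp (\<i> * t)\<close>.
\<close>

lemma fourier_synth_interpolation:
  assumes inj: "inj_on (\<lambda>j. exp (\<i> * of_real (s j))) {..2 * N}"
  shows "fourier_synth N c t = (\<Sum>j\<le>2 * N. fourier_synth N c (s j) * trig_lagrange N s j t)"
proof -
  let ?p = "\<Sum>k\<le>2 * N. monom (c (int k - int N)) k"
  let ?E = "\<lambda>t. exp (\<i> * of_nat N * of_real t) :: complex"
  let ?P = "\<lambda>j. \<Prod>k\<in>{..2 * N} - {j}. (exp (\<i> * of_real t) - exp (\<i> * of_real (s k))) /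
                              (exp (\<i> * of_real (s j)) - exp (\<i> * of_real (s k)))"
  have "degree ?p \<le> 2 * N"
    by (intro degree_sum_le) (auto intro: order.trans[OF degree_monom_le])
  from poly_lagrange_interpolation[OF this inj, of "exp (\<i> * of_real t)"]
  have "?E t * fourier_synth N c t = (\<Sum>j\<le>2 * N. ?E (s j) * fourier_synth N c (s j) * ?P j)"
    by (simp only: fourier_synth_as_poly)
  then have "exp (- (\<i> * of_nat N * of_real t)) * (?E t * fourier_synth N c t) =
      (\<Sum>j\<le>2 * N. exp (- (\<i> * of_nat N * of_real t)) * (?E (s j) * fourier_synth N c (s j) * ?P j))"
    by (simp only: sum_distrib_left)
  moreover have "exp (- (\<i> * of_nat N * of_real t)) * (?E t * fourier_synth N c t) = fourier_synth N c t"
    by (simp add: mult.assoc[symmetric] exp_add[symmetric])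
  moreover have "exp (- (\<i> * of_nat N * of_real t)) * (?E (s j) * fourier_synth N c (s j) * ?P j)
      = fourier_synth N c (s j) * trig_lagrange N s j t" for j
  proof -
    have "exp (- (\<i> * of_nat N * of_real t)) * ?E (s j) = exp (- (\<i> * of_nat N * of_real (t - s j)))"
      by (simp add: exp_add[symmetric] algebra_simps)
    then show ?thesis
      unfolding trig_lagrange_def by (simp add: mult_ac)
  qed
  ultimately show ?thesis by simp
qed

text \<open>
  An interval shorter than \<open>2 * pi\<close> is mapped injectively to the unit circle. For the length
  \<open>2 * pi / T\<close> of \<open>Lam T\<close> this is the condition \<open>T > 1\<close>.
\<close>

lemma exp_equispaced_inj:
  fixes L \<tau> :: real
  assumes "0 < L" "L < 2 * pi"
  shows "inj_on (\<lambda>j. exp (\<i> * of_real (\<tau> + real j * (L / (2 * real N + 1))))) {..2 * N}"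
proof (rule inj_onI)
  define d where "d = L / (2 * real N + 1)"
  have d: "d > 0" "(2 * real N + 1) * d = L" using assms by (simp_all add: d_def)
  fix j k assume jk: "j \<in> {..2 * N}" "k \<in> {..2 * N}"
    and "exp (\<i> * of_real (\<tau> + real j * (L / (2 * real N + 1)))) = exp (\<i> * of_real (\<tau> + real k * (L / (2 * real N + 1))))"
  then have eq: "exp (\<i> * of_real (\<tau> + real j * d)) = exp (\<i> * of_real (\<tau> + real k * d))"
    by (simp only: d_def)
  have "\<bar>real j - real k\<bar> * d \<le> (2 * real N + 1) * d"
    using jk d by (intro mult_right_mono) auto
  then have "\<bar>real j * d - real k * d\<bar> < 2 * pi"
    using assms d by (simp add: abs_mult left_diff_distrib[symmetric])
  then have "\<i> * of_real (\<tau> + real j * d) = \<i> * of_real (\<tau> + real k * d)"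
    by (intro exp_complex_eqI[OF _ eq]) simp
  then have "\<tau> + real j * d = \<tau> + real k * d"
    by (simp only: mult_cancel_left of_real_eq_iff) simp
  then show "j = k" using d by simp
qed

lemma fourier_synth_continuous: "continuous_on S (fourier_synth N c)"
  unfolding fourier_synth_def[abs_def] by (intro continuous_intros)

lemma trig_lagrange_continuous: "continuous_on S (trig_lagrange N s j)"
  unfolding trig_lagrange_def[abs_def] divide_inverse by (intro continuous_intros)

text \<open>
  The bound does not depend on the translation \<open>\<tau>\<close> of the nodes because the denominators of
  the Lagrange functions depend on differences of nodes only.
\<close>

lemma trig_lagrange_equispaced_bound:
  fixes \<delta> :: real
  shows "\<exists>M\<ge>0. \<forall>\<tau>. \<forall>j\<le>2 * N. \<forall>t. norm (trig_lagrange N (\<lambda>j. \<tau> + real j * \<delta>) j t) \<le> M"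
proof -
  define d where "d j k = norm (exp (\<i> * of_real (real j * \<delta>)) - exp (\<i> * of_real (real k * \<delta>)))" for j k
  define M where "M j = (\<Prod>k\<in>{..2 * N} - {j}. 2 / d j k)" for j
  have M0: "0 \<le> M j" for j by (auto simp: M_def d_def intro!: prod_nonneg)
  have d: "norm (exp (\<i> * of_real (\<tau> + real j * \<delta>)) - exp (\<i> * of_real (\<tau> + real k * \<delta>))) = d j k" for \<tau> j k
  proof -
    have "exp (\<i> * of_real (\<tau> + real j * \<delta>)) - exp (\<i> * of_real (\<tau> + real k * \<delta>))
        = exp (\<i> * of_real \<tau>) * (exp (\<i> * of_real (real j * \<delta>)) - exp (\<i> * of_real (real k * \<delta>)))"
      by (simp add: distrib_left exp_add right_diff_distrib)
    then show ?thesis by (simp add: norm_mult d_def)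
  qed
  have "norm (trig_lagrange N (\<lambda>j. \<tau> + real j * \<delta>) j t) \<le> M j" for \<tau> j t
  proof -
    have "norm (trig_lagrange N (\<lambda>j. \<tau> + real j * \<delta>) j t) =
        (\<Prod>k\<in>{..2 * N} - {j}. norm (exp (\<i> * of_real t) - exp (\<i> * of_real (\<tau> + real k * \<delta>))) / d j k)"
      unfolding trig_lagrange_def norm_mult prod_norm[symmetric] norm_divide d by simp
    also have "\<dots> \<le> M j"
      unfolding M_def
    proof (intro prod_mono conjI divide_right_mono)
      fix k
      show "norm (exp (\<i> * of_real t) - exp (\<i> * of_real (\<tau> + real k * \<delta>))) \<le> 2"
        using norm_triangle_ineq4[of "exp (\<i> * of_real t)" "exp (\<i> * of_real (\<tau> + real k * \<delta>))"] by simp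
    qed (auto simp: d_def)
    finally show ?thesis .
  qed
  moreover have "M j \<le> (\<Sum>i\<le>2 * N. M i)" if "j \<le> 2 * N" for j
    using that M0 by (intro member_le_sum) auto
  ultimately show ?thesis
    using M0 by (intro exI[of _ "\<Sum>i\<le>2 * N. M i"]) (meson order.trans sum_nonneg)
qed

lemma Lam_compact: "compact (Lam T)"
  by (simp add: Lam_def)

lemma Lam_lebesgue: "Lam T \<in> sets lebesgue"
  by (simp add: Lam_def)

lemma Lam_borel: "Lam T \<in> sets borel"
  by (simp add: Lam_def)

lemma fourier_synth_L2: "fourier_synth N c \<in> L2space (Lam T)"
  by (rule L2space_continuous[OF Lam_compact fourier_synth_continuous])

text \<open>
  The value at \<open>t\<close> is controlled by the values at any translate of an equispaced grid; averaging
  over the translates that stay in \<open>Lam T\<close> turns these into the \<open>L\<^sup>2\<close> norm.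
\<close>

lemma fourier_synth_pointwise_bound:
  assumes "T > 1"
  shows "\<exists>C\<ge>0. \<forall>c t. norm (fourier_synth N c t) \<le> C * L2norm (Lam T) (fourier_synth N c)"
proof -
  define L where "L = 2 * pi / T"
  have L: "0 < L" "L < 2 * pi" using assms by (auto simp: L_def field_simps)
  define n where "n = 2 * real N + 1"
  have n: "n > 0" by (simp add: n_def)
  define \<delta> where "\<delta> = L / n"
  have \<delta>: "\<delta> > 0" using L n by (simp add: \<delta>_def)
  obtain M where M: "M \<ge> 0" "\<And>\<tau> j t. j \<le> 2 * N \<Longrightarrow> norm (trig_lagrange N (\<lambda>j. \<tau> + real j * \<delta>) j t) \<le> M"
    using trig_lagrange_equispaced_bound[of N \<delta>] by blast
  show ?thesis
  proof (intro exI[of _ "M * n / sqrt \<delta>"] conjI allI)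
    show "0 \<le> M * n / sqrt \<delta>" using M n \<delta> by simp
    fix c t
    define u where "u = fourier_synth N c"
    have cont: "continuous_on X (\<lambda>x. (norm (u x))\<^sup>2)" for X
      unfolding u_def by (intro continuous_intros fourier_synth_continuous)
    have cont_shift: "continuous_on X (\<lambda>\<tau>. (norm (u (\<tau> + d)))\<^sup>2)" for X d
      by (rule continuous_on_compose2[OF cont[of UNIV]]) (auto intro!: continuous_intros)
    \<comment> \<open>interpolation at the grid translated by \<open>\<tau>\<close>\<close>
    have grid: "(norm (u t))\<^sup>2 \<le> M\<^sup>2 * n * (\<Sum>j\<le>2 * N. (norm (u (\<tau> + real j * \<delta>)))\<^sup>2)" for \<tau>
    proof -
      have "norm (u t) \<le> (\<Sum>j\<le>2 * N. norm (u (\<tau> + real j * \<delta>)) * M)"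
        unfolding u_def
        by (subst fourier_synth_interpolation[OF exp_equispaced_inj[OF L, of \<tau> N, folded n_def \<delta>_def]])
           (auto simp: norm_mult intro!: order.trans[OF norm_sum] sum_mono mult_left_mono M(2))
      then have "(norm (u t))\<^sup>2 \<le> (\<Sum>j\<le>2 * N. norm (u (\<tau> + real j * \<delta>)) * M)\<^sup>2"
        by (intro power_mono) auto
      also have "\<dots> \<le> (\<Sum>j\<le>2 * N. (norm (u (\<tau> + real j * \<delta>)) * M)\<^sup>2) * card {..2 * N}"
        by (rule sum_squared_le_sum_of_squares)
      also have "\<dots> = M\<^sup>2 * n * (\<Sum>j\<le>2 * N. (norm (u (\<tau> + real j * \<delta>)))\<^sup>2)"
      proof -
        have "real (card {..2 * N}) = n" by (simp add: n_def)
        then show ?thesis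
          by (simp only: power_mult_distrib sum_distrib_left mult_ac)
      qed
      finally show ?thesis .
    qed
    have shift: "integral {0..\<delta>} (\<lambda>\<tau>. (norm (u (\<tau> + real j * \<delta>)))\<^sup>2) \<le> (L2norm (Lam T) u)\<^sup>2" if "j \<le> 2 * N" for j
    proof -
      have "integral {0..\<delta>} (\<lambda>\<tau>. (norm (u (\<tau> + real j * \<delta>)))\<^sup>2) = integral {real j * \<delta>..\<delta> + real j * \<delta>} (\<lambda>\<tau>. (norm (u \<tau>))\<^sup>2)"
        using integral_shift_Icc_real[of 0 \<delta> "\<lambda>x. (norm (u x))\<^sup>2" "real j * \<delta>"] by (simp add: o_def add.commute)
      also have "\<dots> \<le> integral {0..L} (\<lambda>\<tau>. (norm (u \<tau>))\<^sup>2)"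
      proof (rule integral_subset_le)
        have "real j + 1 \<le> n" using that by (simp add: n_def)
        then have "(real j + 1) * \<delta> \<le> n * \<delta>" using \<delta> by (intro mult_right_mono) auto
        moreover have "n * \<delta> = L" using n by (simp add: \<delta>_def)
        moreover have "0 \<le> real j * \<delta>" using \<delta> by simp
        ultimately show "{real j * \<delta>..\<delta> + real j * \<delta>} \<subseteq> {0..L}"
          by (auto simp: distrib_right)
      qed (auto intro!: integrable_continuous_interval cont)
      also have "\<dots> = (L2norm (Lam T) u)\<^sup>2"
        unfolding L2norm_square Lam_def L_def[symmetric]
        by (rule lebesgue_integral_eq_integral[symmetric])
           (auto intro!: continuous_imp_integrable_real cont)
      finally show ?thesis .
    qed
    have "\<delta> * (norm (u t))\<^sup>2 = integral {0..\<delta>} (\<lambda>\<tau>. (norm (u t))\<^sup>2)"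
      using \<delta> by simp
    also have "\<dots> \<le> integral {0..\<delta>} (\<lambda>\<tau>. M\<^sup>2 * n * (\<Sum>j\<le>2 * N. (norm (u (\<tau> + real j * \<delta>)))\<^sup>2))"
      using grid
      by (intro integral_le integrable_continuous_interval continuous_on_const continuous_on_mult
            continuous_on_sum cont_shift)
    also have "\<dots> = M\<^sup>2 * n * (\<Sum>j\<le>2 * N. integral {0..\<delta>} (\<lambda>\<tau>. (norm (u (\<tau> + real j * \<delta>)))\<^sup>2))"
      by (subst integral_mult_right, subst integral_sum)
         (auto intro!: integrable_continuous_interval cont_shift)
    also have "\<dots> \<le> M\<^sup>2 * n * (\<Sum>j\<le>2 * N. (L2norm (Lam T) u)\<^sup>2)"
      using n by (intro mult_left_mono sum_mono shift) auto
    also have "\<dots> = (M * n * L2norm (Lam T) u)\<^sup>2"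
      by (simp add: power_mult_distrib n_def power2_eq_square algebra_simps)
    finally have "(sqrt \<delta> * norm (u t))\<^sup>2 \<le> (M * n * L2norm (Lam T) u)\<^sup>2"
      using \<delta> by (simp add: power_mult_distrib)
    then have "sqrt \<delta> * norm (u t) \<le> M * n * L2norm (Lam T) u"
      by (rule power2_le_imp_le) (intro mult_nonneg_nonneg M(1) less_imp_le[OF n] L2norm_nonneg)
    then show "norm (fourier_synth N c t) \<le> M * n / sqrt \<delta> * L2norm (Lam T) (fourier_synth N c)"
      using \<delta> by (simp add: u_def field_simps)
  qed
qed

section \<open>Best-approximation defects\<close>

lemma coeff_norm_nonneg: "0 \<le> coeff_norm N c"
  by (simp add: coeff_norm_def)

lemma approx_defect_bdd_below:
  assumes "\<epsilon> \<ge> 0"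
  shows "bdd_below (range (\<lambda>c. L2norm (Lam T) (\<lambda>t. v t - fourier_synth N c t) + \<epsilon> * coeff_norm N c))"
  using assms by (intro bdd_belowI[of _ 0]) (auto simp: L2norm_nonneg coeff_norm_nonneg)

lemma approx_defect_nonneg:
  assumes "\<epsilon> \<ge> 0"
  shows "0 \<le> approx_defect T N \<epsilon> v"
  unfolding approx_defect_def using assms
  by (intro cINF_greatest) (auto simp: L2norm_nonneg coeff_norm_nonneg)

text \<open>
  The zero coefficient vector is admissible. This makes the squared defects integrable along the
  slices of a square integrable function.
\<close>

lemma approx_defect_le_L2norm:
  assumes "\<epsilon> \<ge> 0"
  shows "approx_defect T N \<epsilon> v \<le> L2norm (Lam T) v"
proof -
  have "approx_defect T N \<epsilon> v \<le>
      L2norm (Lam T) (\<lambda>t. v t - fourier_synth N (\<lambda>_. 0) t) + \<epsilon> * coeff_norm N (\<lambda>_. 0)"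
    unfolding approx_defect_def by (rule cINF_lower[OF approx_defect_bdd_below[OF assms] UNIV_I])
  then show ?thesis by (simp add: fourier_synth_def coeff_norm_def L2_set_def)
qed

lemma fourier_synth_diff:
  "fourier_synth N c t - fourier_synth N c' t = fourier_synth N (\<lambda>l. c l - c' l) t"
  by (simp add: fourier_synth_def sum_subtractf left_diff_distrib)

lemma norm_fourier_synth_le: "norm (fourier_synth N c t) \<le> (\<Sum>l\<in>{- int N..int N}. norm (c l))"
proof -
  have "norm (exp (\<i> * of_int l * of_real t)) = 1" for l
    by (simp add: norm_exp_eq_Re)
  then show ?thesis
    unfolding fourier_synth_def by (intro order.trans[OF norm_sum]) (simp add: norm_mult)
qed

lemma L2norm_mono:
  assumes v: "v \<in> L2space S" and w: "w \<in> L2space S"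
    and le: "\<And>x. x \<in> S \<Longrightarrow> norm (v x) \<le> norm (w x)"
  shows "L2norm S v \<le> L2norm S w"
  unfolding L2norm_def using v w le
  by (intro real_sqrt_le_mono integral_mono) (auto simp: L2space_def intro!: power_mono)

text \<open>
  The quantity to be minimised is continuous in the coefficients, so a countable dense set of
  coefficient vectors gives the same infimum. An infimum over countably many vectors is measurable
  in a parameter, which is what makes the directional defects measurable.
\<close>

lemma approx_defect_countable:
  assumes \<epsilon>: "\<epsilon> \<ge> 0"
  obtains C where "countable C"
    "\<And>T v. v \<in> L2space (Lam T) \<Longrightarrow> approx_defect T N \<epsilon> v =
        (INF c\<in>C. L2norm (Lam T) (\<lambda>t. v t - fourier_synth N c t) + \<epsilon> * coeff_norm N c)"
proof -
  let ?I = "{- int N..int N}"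
  obtain D :: "complex set" where D: "countable D" "\<And>X. open X \<Longrightarrow> X \<noteq> {} \<Longrightarrow> \<exists>d\<in>D. d \<in> X"
    by (erule countable_dense_setE)
  define C where "C = PiE ?I (\<lambda>_. D)"
  have "countable C" unfolding C_def using D(1) by (intro countable_PiE) auto
  have approx: "\<exists>c'\<in>C. \<forall>l\<in>?I. norm (c' l - c l) < \<eta>" if "\<eta> > 0" for c :: "int \<Rightarrow> complex" and \<eta>
  proof -
    have "\<forall>l. \<exists>d\<in>D. d \<in> ball (c l) \<eta>"
      using D(2)[of "ball _ \<eta>"] that by simp
    then obtain d where d: "\<And>l. d l \<in> D" "\<And>l. d l \<in> ball (c l) \<eta>" by metis
    show ?thesis
      using d by (intro bexI[of _ "restrict d ?I"]) (auto simp: C_def dist_norm norm_minus_commute)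
  qed
  then have "C \<noteq> {}" using zero_less_one by blast
  have "approx_defect T N \<epsilon> v =
      (INF c\<in>C. L2norm (Lam T) (\<lambda>t. v t - fourier_synth N c t) + \<epsilon> * coeff_norm N c)"
    if v: "v \<in> L2space (Lam T)" for T v
  proof -
    define J where "J c = L2norm (Lam T) (\<lambda>t. v t - fourier_synth N c t) + \<epsilon> * coeff_norm N c" for c
    have bdd: "bdd_below (J ` X)" for X
      using approx_defect_bdd_below[OF \<epsilon>, of T v N] unfolding J_def[abs_def] by (rule bdd_below_mono) auto
    have one: "(\<lambda>t. 1) \<in> L2space (Lam T)" by (intro L2space_continuous Lam_compact) auto
    have "(INF c\<in>C. J c) \<le> J c" for c
    proof (rule field_le_epsilon)
      fix e :: real assume e: "e > 0"
      define K where "K = (2 * real N + 1) * (L2norm (Lam T) (\<lambda>t. 1) + \<epsilon>)"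
      have K: "K \<ge> 0" using \<epsilon> by (simp add: K_def L2norm_nonneg)
      \<comment> \<open>\<open>K * \<eta>\<close> bounds the change of the functional when every coefficient moves by less than \<open>\<eta>\<close>\<close>
      define \<eta> where "\<eta> = e / (K + 1)"
      have \<eta>: "\<eta> > 0" "K * \<eta> \<le> e" using e K by (auto simp: \<eta>_def field_simps)
      obtain c' where c': "c' \<in> C" "\<And>l. l \<in> ?I \<Longrightarrow> norm (c' l - c l) < \<eta>"
        using approx[OF \<eta>(1)] by blast
      define b where "b l = c l - c' l" for l
      have b: "(\<Sum>l\<in>?I. norm (b l)) \<le> (2 * real N + 1) * \<eta>"
      proof -
        have "(\<Sum>l\<in>?I. norm (b l)) \<le> (\<Sum>l\<in>?I. \<eta>)"
          using c'(2) by (intro sum_mono) (auto simp: b_def norm_minus_commute less_imp_le)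
        also have "\<dots> = (2 * real N + 1) * \<eta>" by simp
        finally show ?thesis .
      qed
      have const: "norm (complex_of_real ((2 * real N + 1) * \<eta>)) = (2 * real N + 1) * \<eta>"
        unfolding norm_of_real using \<eta> by simp
      have "L2norm (Lam T) (fourier_synth N b) \<le> L2norm (Lam T) (\<lambda>t. complex_of_real ((2 * real N + 1) * \<eta>) * 1)"
      proof (intro L2norm_mono fourier_synth_L2 L2space_mult one)
        fix t show "norm (fourier_synth N b t) \<le> norm (complex_of_real ((2 * real N + 1) * \<eta>) * 1)"
          unfolding mult_1_right const using order.trans[OF norm_fourier_synth_le b] .
      qed
      also have "\<dots> = (2 * real N + 1) * \<eta> * L2norm (Lam T) (\<lambda>t. 1)"
        unfolding L2norm_mult const ..
      finally have 1: "L2norm (Lam T) (fourier_synth N b) \<le> (2 * real N + 1) * \<eta> * L2norm (Lam T) (\<lambda>t. 1)" .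
      have "L2norm (Lam T) (\<lambda>t. v t - fourier_synth N c' t)
          = L2norm (Lam T) (\<lambda>t. (v t - fourier_synth N c t) + fourier_synth N b t)"
        unfolding b_def[abs_def] fourier_synth_diff[symmetric] by simp
      also have "\<dots> \<le> L2norm (Lam T) (\<lambda>t. v t - fourier_synth N c t) + L2norm (Lam T) (fourier_synth N b)"
        by (intro L2norm_triangle L2space_diff v fourier_synth_L2)
      finally have 2: "L2norm (Lam T) (\<lambda>t. v t - fourier_synth N c' t)
          \<le> L2norm (Lam T) (\<lambda>t. v t - fourier_synth N c t) + L2norm (Lam T) (fourier_synth N b)" .
      have "coeff_norm N c' \<le> L2_set (\<lambda>l. norm (c l) + norm (b l)) ?I"
        unfolding coeff_norm_def b_def
        by (intro L2_set_mono) (auto intro: order.trans[OF norm_triangle_sub] simp: norm_minus_commute)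
      also have "\<dots> \<le> coeff_norm N c + L2_set (\<lambda>l. norm (b l)) ?I"
        unfolding coeff_norm_def by (rule L2_set_triangle_ineq)
      also have "L2_set (\<lambda>l. norm (b l)) ?I \<le> (\<Sum>l\<in>?I. norm (b l))"
        by (rule L2_set_le_sum) auto
      finally have "coeff_norm N c' \<le> coeff_norm N c + (2 * real N + 1) * \<eta>" using b by simp
      then have 3: "\<epsilon> * coeff_norm N c' \<le> \<epsilon> * (coeff_norm N c + (2 * real N + 1) * \<eta>)"
        using \<epsilon> by (rule mult_left_mono)
      have "(INF c\<in>C. J c) \<le> J c'"
        by (rule cINF_lower[OF bdd c'(1)])
      also have "\<dots> \<le> J c + K * \<eta>"
        using 1 2 3 by (simp add: J_def K_def algebra_simps)
      also have "\<dots> \<le> J c + e" using \<eta> by simp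
      finally show "(INF c\<in>C. J c) \<le> J c + e" .
    qed
    then have "(INF c\<in>C. J c) \<le> (INF c. J c)"
      by (intro cINF_greatest) auto
    moreover have "(INF c. J c) \<le> (INF c\<in>C. J c)"
      using bdd \<open>C \<noteq> {}\<close> by (intro cINF_superset_mono) auto
    ultimately show ?thesis
      unfolding approx_defect_def J_def[symmetric] by simp
  qed
  then show ?thesis using that \<open>countable C\<close> by blast
qed

lemma approx_defect_slice_measurable:
  fixes f :: "'a::euclidean_space \<times> real \<Rightarrow> complex"
  assumes \<epsilon>: "\<epsilon> \<ge> 0" and A: "compact A" and f: "f \<in> L2space (A \<times> Lam T)"
  shows "(\<lambda>x. approx_defect T N \<epsilon> (\<lambda>t. f (x, t))) \<in> borel_measurable (lebesgue_on A)"
proof -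
  have A': "A \<in> sets borel" using A by (simp add: compact_imp_closed)
  obtain C where C: "countable C"
    "\<And>T v. v \<in> L2space (Lam T) \<Longrightarrow> approx_defect T N \<epsilon> v =
        (INF c\<in>C. L2norm (Lam T) (\<lambda>t. v t - fourier_synth N c t) + \<epsilon> * coeff_norm N c)"
    using approx_defect_countable[OF \<epsilon>, of N] by blast
  define J where "J c x = L2norm (Lam T) (\<lambda>t. f (x, t) - fourier_synth N c t) + \<epsilon> * coeff_norm N c" for c x
  have J: "J c \<in> borel_measurable (lebesgue_on A)" for c
  proof -
    have "(\<lambda>z. fourier_synth N c (snd z)) \<in> L2space (A \<times> Lam T)"
      by (intro L2space_continuous compact_Times A Lam_compact
            continuous_on_compose2[OF fourier_synth_continuous[of UNIV]] continuous_intros) auto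
    then have "(\<lambda>z. f z - fourier_synth N c (snd z)) \<in> L2space (A \<times> Lam T)"
      by (rule L2space_diff[OF f])
    from L2space_slices(2)[OF A' Lam_borel this]
    have "(\<lambda>x. (L2norm (Lam T) (\<lambda>t. f (x, t) - fourier_synth N c t))\<^sup>2) \<in> borel_measurable (lebesgue_on A)"
      by (simp add: borel_measurable_integrable)
    then have "(\<lambda>x. sqrt ((L2norm (Lam T) (\<lambda>t. f (x, t) - fourier_synth N c t))\<^sup>2)) \<in> borel_measurable (lebesgue_on A)"
      by measurable
    then have "(\<lambda>x. L2norm (Lam T) (\<lambda>t. f (x, t) - fourier_synth N c t)) \<in> borel_measurable (lebesgue_on A)"
      by (simp add: L2norm_nonneg)
    then show ?thesis unfolding J_def[abs_def] by simp
  qed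
  have inf: "(\<lambda>x. INF c\<in>C. J c x) \<in> borel_measurable (lebesgue_on A)"
    by (rule borel_measurable_cINF_real[OF C(1) J])
  show ?thesis
  proof (rule borel_measurable_lebesgue_on_cong_AE[OF _ inf])
    show "AE x in lebesgue_on A. (INF c\<in>C. J c x) = approx_defect T N \<epsilon> (\<lambda>t. f (x, t))"
      using L2space_slices(1)[OF A' Lam_borel f] by eventually_elim (simp add: C(2) J_def)
  qed (use A' in simp)
qed

section \<open>Bounded reconstruction operators\<close>

definition fourier_reconstruction :: "real \<Rightarrow> nat \<Rightarrow> ((real \<Rightarrow> complex) \<Rightarrow> real \<Rightarrow> complex) \<Rightarrow> bool" where
  "fourier_reconstruction T N Q \<longleftrightarrow> L2_linear_op (Lam T) (fourier_space T N) Q \<and>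
     (\<exists>B. \<forall>v\<in>L2space (Lam T). L2norm (Lam T) (Q v) \<le> B * L2norm (Lam T) v)"

lemma L2_linear_opD:
  assumes "L2_linear_op S H Q" "v \<in> L2space S"
  shows "Q v \<in> H"
    and "w \<in> L2space S \<Longrightarrow> AE t in lebesgue_on S. v t = w t \<Longrightarrow> t \<in> S \<Longrightarrow> Q v t = Q w t"
    and "w \<in> L2space S \<Longrightarrow> t \<in> S \<Longrightarrow> Q (\<lambda>x. v x + w x) t = Q v t + Q w t"
    and "t \<in> S \<Longrightarrow> Q (\<lambda>x. a * v x) t = a * Q v t"
proof -
  note Q = assms(1)[unfolded L2_linear_op_def]
  show "Q v \<in> H"
    using conjunct1[OF Q] assms(2) by (rule bspec)
  show "w \<in> L2space S \<Longrightarrow> AE t in lebesgue_on S. v t = w t \<Longrightarrow> t \<in> S \<Longrightarrow> Q v t = Q w t"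
    using conjunct1[OF conjunct2[OF Q]] assms(2) by blast
  show "w \<in> L2space S \<Longrightarrow> t \<in> S \<Longrightarrow> Q (\<lambda>x. v x + w x) t = Q v t + Q w t"
    using conjunct1[OF conjunct2[OF conjunct2[OF Q]]] assms(2) by blast
  show "t \<in> S \<Longrightarrow> Q (\<lambda>x. a * v x) t = a * Q v t"
    using conjunct2[OF conjunct2[OF conjunct2[OF Q]]] assms(2) by blast
qed

lemma L2_linear_op_fourier_synthE:
  assumes "L2_linear_op (Lam T) (fourier_space T N) Q" "v \<in> L2space (Lam T)"
  obtains c where "\<And>t. t \<in> Lam T \<Longrightarrow> Q v t = fourier_synth N c t"
proof -
  have "Q v \<in> fourier_space T N" using assms by (rule L2_linear_opD(1))
  then show ?thesis using that unfolding fourier_space_def by blast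
qed

lemma L2_linear_op_imp_L2:
  assumes "L2_linear_op (Lam T) (fourier_space T N) Q" "v \<in> L2space (Lam T)"
  shows "Q v \<in> L2space (Lam T)"
proof -
  obtain c where "\<And>t. t \<in> Lam T \<Longrightarrow> Q v t = fourier_synth N c t"
    by (rule L2_linear_op_fourier_synthE[OF assms]) blast
  then show ?thesis
    using L2space_cong[OF Lam_lebesgue, of T "Q v" "fourier_synth N c"] fourier_synth_L2 by blast
qed

text \<open>
  The error of \<open>Q v\<close> is at most the norm of \<open>v\<close>, so \<open>Q\<close> has operator norm at most 2.
\<close>

lemma fourier_reconstruction_of_error_bound:
  assumes Q: "L2_linear_op (Lam T) (fourier_space T N) Q" and \<epsilon>: "\<epsilon> \<ge> 0"
    and err: "\<forall>v\<in>L2space (Lam T). L2norm (Lam T) (\<lambda>t. v t - Q v t) \<le> approx_defect T N \<epsilon> v"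
  shows "fourier_reconstruction T N Q"
proof -
  have "L2norm (Lam T) (Q v) \<le> 2 * L2norm (Lam T) v" if v: "v \<in> L2space (Lam T)" for v
  proof -
    note Qv = L2_linear_op_imp_L2[OF Q v]
    have "L2norm (Lam T) (\<lambda>t. v t + (Q v t - v t)) \<le> L2norm (Lam T) v + L2norm (Lam T) (\<lambda>t. Q v t - v t)"
      by (intro L2norm_triangle L2space_diff v Qv)
    moreover have "L2norm (Lam T) (\<lambda>t. v t - Q v t) \<le> L2norm (Lam T) v"
      using err v approx_defect_le_L2norm[OF \<epsilon>, of T N v] by fastforce
    ultimately show ?thesis by (simp add: L2norm_minus_commute[of _ "Q v" v])
  qed
  then show ?thesis using Q by (auto simp: fourier_reconstruction_def)
qed

text \<open>
  On the finite-dimensional range of \<open>Q\<close> the value at a point is dominated by the \<open>L\<^sup>2\<close> norm.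
\<close>

lemma fourier_reconstruction_functional:
  assumes T: "T > 1" and Q: "fourier_reconstruction T N Q" and t: "t \<in> Lam T"
  shows "L2_functional (Lam T) (\<lambda>v. Q v t)"
proof -
  have op: "L2_linear_op (Lam T) (fourier_space T N) Q"
    using Q by (simp add: fourier_reconstruction_def)
  obtain B where B: "\<And>v. v \<in> L2space (Lam T) \<Longrightarrow> L2norm (Lam T) (Q v) \<le> B * L2norm (Lam T) v"
    using Q unfolding fourier_reconstruction_def by blast
  obtain C where C: "C \<ge> 0" "\<And>c t. norm (fourier_synth N c t) \<le> C * L2norm (Lam T) (fourier_synth N c)"
    using fourier_synth_pointwise_bound[OF T] by blast
  have "norm (Q v t) \<le> (C * B) * L2norm (Lam T) v" if v: "v \<in> L2space (Lam T)" for v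
  proof -
    obtain c where c: "\<And>t. t \<in> Lam T \<Longrightarrow> Q v t = fourier_synth N c t"
      by (rule L2_linear_op_fourier_synthE[OF op v]) blast
    have "norm (Q v t) \<le> C * L2norm (Lam T) (Q v)"
      using C(2)[of c t] c t L2norm_cong[of "Lam T" "Q v" "fourier_synth N c"] by simp
    also have "\<dots> \<le> C * (B * L2norm (Lam T) v)"
      using B[OF v] C(1) by (rule mult_left_mono)
    finally show ?thesis by simp
  qed
  then show ?thesis
    unfolding L2_functional_def
    by (intro conjI ballI allI exI[of _ "C * B"] L2_linear_opD(3)[OF op _ _ t] L2_linear_opD(4)[OF op _ t])
qed

text \<open>
  Nodes and basis functions do not depend on the function that is reconstructed. When this
  function is a slice, the formula separates the parameter of the slice from the variable of the
  reconstruction, which reduces joint measurability to measurability in the parameter.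
\<close>

lemma fourier_reconstruction_interpolation:
  assumes T: "T > 1"
  obtains \<sigma> :: "nat \<Rightarrow> real" and w :: "nat \<Rightarrow> real \<Rightarrow> complex"
  where "\<And>j. j \<le> 2 * N \<Longrightarrow> \<sigma> j \<in> Lam T" "\<And>j S. continuous_on S (w j)"
    "\<And>Q v t. fourier_reconstruction T N Q \<Longrightarrow> v \<in> L2space (Lam T) \<Longrightarrow> t \<in> Lam T \<Longrightarrow>
        Q v t = (\<Sum>j\<le>2 * N. Q v (\<sigma> j) * w j t)"
proof -
  define L where "L = 2 * pi / T"
  have L: "0 < L" "L < 2 * pi" using T by (auto simp: L_def field_simps)
  define \<sigma> where "\<sigma> = (\<lambda>j. 0 + real j * (L / (2 * real N + 1)))"
  have \<sigma>: "\<sigma> j \<in> Lam T" if "j \<le> 2 * N" for j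
  proof -
    have "real j * (L / (2 * real N + 1)) \<le> (2 * real N + 1) * (L / (2 * real N + 1))"
      using that L by (intro mult_right_mono) auto
    then show ?thesis using L by (simp add: \<sigma>_def Lam_def L_def[symmetric])
  qed
  have "Q v t = (\<Sum>j\<le>2 * N. Q v (\<sigma> j) * trig_lagrange N \<sigma> j t)"
    if Qvt: "fourier_reconstruction T N Q" "v \<in> L2space (Lam T)" "t \<in> Lam T" for Q v t
  proof -
    obtain c where c: "\<And>t. t \<in> Lam T \<Longrightarrow> Q v t = fourier_synth N c t"
      using L2_linear_op_fourier_synthE Qvt(1,2) unfolding fourier_reconstruction_def by blast
    have "fourier_synth N c t = (\<Sum>j\<le>2 * N. fourier_synth N c (\<sigma> j) * trig_lagrange N \<sigma> j t)"
      unfolding \<sigma>_def by (rule fourier_synth_interpolation[OF exp_equispaced_inj[OF L]])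
    then show ?thesis using c \<sigma> Qvt(3) by simp
  qed
  then show ?thesis
    using that[of \<sigma> "trig_lagrange N \<sigma>"] \<sigma> trig_lagrange_continuous by blast
qed

section \<open>The error on the rectangle\<close>

lemma AE_lebesgue_on_fst:
  fixes A :: "'a::euclidean_space set" and B :: "'b::euclidean_space set"
  assumes A: "A \<in> sets borel" and B: "B \<in> sets borel" and P: "AE x in lebesgue_on A. P x"
  shows "AE z in lebesgue_on (A \<times> B). P (fst z)"
proof -
  have AB: "A \<times> B \<in> sets borel" using A B by (auto intro: borel_Times)
  have "AE x in lborel. x \<in> A \<longrightarrow> P x"
    using P A by (simp add: AE_restrict_space_iff AE_completion_iff)
  then obtain N where N: "N \<in> null_sets lborel" "{x \<in> space lborel. \<not> (x \<in> A \<longrightarrow> P x)} \<subseteq> N"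
    by (auto simp: eventually_ae_filter)
  have "emeasure (lborel \<Otimes>\<^sub>M lborel) (N \<times> (UNIV :: 'b set)) = emeasure lborel N * emeasure lborel (UNIV :: 'b set)"
    using N(1) by (intro lborel.emeasure_pair_measure_Times) (auto dest: null_setsD2)
  also have "emeasure lborel N = 0" using N(1) by (rule null_setsD1)
  finally have "N \<times> (UNIV :: 'b set) \<in> null_sets (lborel \<Otimes>\<^sub>M lborel)"
    using N(1) by (intro null_setsI pair_measureI) (auto dest: null_setsD2)
  then have N2: "N \<times> (UNIV :: 'b set) \<in> null_sets lborel"
    by (simp only: lborel_prod)
  have "AE z in lborel. z \<in> A \<times> B \<longrightarrow> P (fst z)"
    by (rule AE_I'[OF N2]) (use N(2) in auto)
  then show ?thesis
    using AB by (simp add: AE_restrict_space_iff AE_completion_iff)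
qed

lemma borel_measurable_lebesgue_on_fst:
  fixes \<phi> :: "'a::euclidean_space \<Rightarrow> complex" and B :: "'b::euclidean_space set"
  assumes A: "A \<in> sets borel" and B: "B \<in> sets borel" and \<phi>: "\<phi> \<in> borel_measurable (lebesgue_on A)"
  shows "(\<lambda>z. \<phi> (fst z)) \<in> borel_measurable (lebesgue_on (A \<times> B))"
proof -
  have AB: "A \<times> B \<in> sets borel" using A B by (auto intro: borel_Times)
  have "(\<lambda>x. if x \<in> A then \<phi> x else 0) \<in> borel_measurable lebesgue"
    using \<phi> A by (subst borel_measurable_if) auto
  then obtain k where k: "k \<in> borel_measurable lborel"
    and eq: "AE x in lborel. (if x \<in> A then \<phi> x else 0) = k x"
    using completion_ex_borel_measurable_complex by blast
  have "AE x in lborel. x \<in> A \<longrightarrow> k x = \<phi> x"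
    using eq by eventually_elim auto
  then have "AE x in lebesgue_on A. k x = \<phi> x"
    using A by (simp add: AE_restrict_space_iff AE_completion_iff)
  note ae = AE_lebesgue_on_fst[OF A B this]
  have "fst \<in> (borel :: ('a \<times> 'b) measure) \<rightarrow>\<^sub>M borel"
    by (intro borel_measurable_continuous_onI continuous_intros)
  from measurable_compose[OF this, of k borel] k
  have "(\<lambda>z :: 'a \<times> 'b. k (fst z)) \<in> borel_measurable (lebesgue_on (A \<times> B))"
    by (intro measurable_restrict_space1 measurable_completion) simp
  from borel_measurable_lebesgue_on_cong_AE[OF _ this ae] show ?thesis
    using AB by simp
qed

text \<open>
  By interpolation the function is almost everywhere a finite sum of products of a function of the
  parameter, measurable because point evaluations of \<open>Q\<close> are bounded functionals, and a continuous
  function of the other variable.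
\<close>

lemma fourier_reconstruction_slices_L2:
  fixes f :: "'a::euclidean_space \<times> real \<Rightarrow> complex"
  assumes T: "T > 1" and Q: "fourier_reconstruction T N Q" and A: "compact A"
    and f: "f \<in> L2space (A \<times> Lam T)"
  shows "(\<lambda>z. Q (\<lambda>t. f (fst z, t)) (snd z)) \<in> L2space (A \<times> Lam T)"
proof -
  have A': "A \<in> sets borel" using A by (simp add: compact_imp_closed)
  have AL: "A \<times> Lam T \<in> sets lebesgue"
    using A' Lam_borel[of T] by (simp add: borel_Times)
  have op: "L2_linear_op (Lam T) (fourier_space T N) Q"
    using Q by (simp add: fourier_reconstruction_def)
  obtain B where B: "\<And>v. v \<in> L2space (Lam T) \<Longrightarrow> L2norm (Lam T) (Q v) \<le> B * L2norm (Lam T) v"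
    using Q unfolding fourier_reconstruction_def by blast
  obtain \<sigma> w where \<sigma>: "\<And>j. j \<le> 2 * N \<Longrightarrow> \<sigma> j \<in> Lam T" and w: "\<And>j S. continuous_on S (w j :: real \<Rightarrow> complex)"
    and interp: "\<And>Q v t. fourier_reconstruction T N Q \<Longrightarrow> v \<in> L2space (Lam T) \<Longrightarrow> t \<in> Lam T \<Longrightarrow>
        Q v t = (\<Sum>j\<le>2 * N. Q v (\<sigma> j) * w j t)"
    using fourier_reconstruction_interpolation[OF T, of N] by blast
  have slice: "AE x in lebesgue_on A. (\<lambda>t. f (x, t)) \<in> L2space (Lam T)"
    by (rule L2space_slices(1)[OF A' Lam_borel f])
  let ?R = "\<lambda>z. \<Sum>j\<le>2 * N. Q (\<lambda>t. f (fst z, t)) (\<sigma> j) * w j (snd z)"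
  have "?R \<in> borel_measurable (lebesgue_on (A \<times> Lam T))"
  proof (intro borel_measurable_sum borel_measurable_times)
    fix j assume "j \<in> {..2 * N}"
    then have "(\<lambda>x. Q (\<lambda>t. f (x, t)) (\<sigma> j)) \<in> borel_measurable (lebesgue_on A)"
      using \<sigma> by (intro L2_functional_slice_measurable[OF fourier_reconstruction_functional[OF T Q] Lam_compact A' f]) auto
    then show "(\<lambda>z. Q (\<lambda>t. f (fst z, t)) (\<sigma> j)) \<in> borel_measurable (lebesgue_on (A \<times> Lam T))"
      by (rule borel_measurable_lebesgue_on_fst[OF A' Lam_borel])
    show "(\<lambda>z. w j (snd z)) \<in> borel_measurable (lebesgue_on (A \<times> Lam T))"
      by (intro continuous_imp_measurable_on_sets_lebesgue AL continuous_on_compose2[OF w[of UNIV]] continuous_intros) auto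
  qed
  moreover have "AE z in lebesgue_on (A \<times> Lam T). ?R z = Q (\<lambda>t. f (fst z, t)) (snd z)"
    using AE_lebesgue_on_fst[OF A' Lam_borel slice] AE_space
    by eventually_elim (auto simp: interp[OF Q])
  ultimately have meas: "(\<lambda>z. Q (\<lambda>t. f (fst z, t)) (snd z)) \<in> borel_measurable (lebesgue_on (A \<times> Lam T))"
    by (rule borel_measurable_lebesgue_on_cong_AE[OF AL])
  show ?thesis
  proof (rule L2space_from_slices(1)[OF A' Lam_borel meas f])
    show "0 \<le> max B 0" by simp
    show "AE x in lebesgue_on A. (\<lambda>y. Q (\<lambda>t. f (fst (x, y), t)) (snd (x, y))) \<in> L2space (Lam T) \<and>
        L2norm (Lam T) (\<lambda>y. Q (\<lambda>t. f (fst (x, y), t)) (snd (x, y))) \<le> max B 0 * L2norm (Lam T) (\<lambda>y. f (x, y))"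
      using slice
    proof eventually_elim
      case (elim x)
      have "L2norm (Lam T) (Q (\<lambda>y. f (x, y))) \<le> B * L2norm (Lam T) (\<lambda>y. f (x, y))"
        by (rule B[OF elim])
      also have "\<dots> \<le> max B 0 * L2norm (Lam T) (\<lambda>y. f (x, y))"
        by (intro mult_right_mono L2norm_nonneg) simp
      finally show ?case
        using L2_linear_op_imp_L2[OF op elim] by simp
    qed
  qed
qed

lemma slice_error_eq_L2norm:
  fixes f :: "'a::euclidean_space \<times> real \<Rightarrow> complex"
  assumes T: "T > 1" and Q: "fourier_reconstruction T N Q" and A: "compact A"
    and f: "f \<in> L2space (A \<times> Lam T)"
  defines "E \<equiv> \<lambda>z. f z - Q (\<lambda>t. f (fst z, t)) (snd z)"
  shows "E \<in> L2space (A \<times> Lam T)"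
    and "sqrt (\<integral>x. (L2norm (Lam T) (\<lambda>t. f (x, t) - Q (\<lambda>t'. f (x, t')) t))\<^sup>2 \<partial>lebesgue_on A) = L2norm (A \<times> Lam T) E"
proof -
  have A': "A \<in> sets borel" using A by (simp add: compact_imp_closed)
  show E: "E \<in> L2space (A \<times> Lam T)"
    unfolding E_def by (rule L2space_diff[OF f fourier_reconstruction_slices_L2[OF T Q A f]])
  show "sqrt (\<integral>x. (L2norm (Lam T) (\<lambda>t. f (x, t) - Q (\<lambda>t'. f (x, t')) t))\<^sup>2 \<partial>lebesgue_on A) = L2norm (A \<times> Lam T) E"
    using L2space_slices(3)[OF A' Lam_borel E] by (simp add: E_def L2norm_nonneg)
qed

text \<open>
  The pointwise estimate is integrated over the parameter. Both integrands have to be integrable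
  here, since a divergent Bochner integral on the right would have the value 0.
\<close>

lemma slice_error_le_defect:
  fixes f :: "'a::euclidean_space \<times> real \<Rightarrow> complex"
  assumes T: "T > 1" and Q: "fourier_reconstruction T N Q" and A: "compact A"
    and f: "f \<in> L2space (A \<times> Lam T)" and \<epsilon>: "\<epsilon> \<ge> 0"
    and err: "\<forall>v\<in>L2space (Lam T). L2norm (Lam T) (\<lambda>t. v t - Q v t) \<le> approx_defect T N \<epsilon> v"
  shows "sqrt (\<integral>x. (L2norm (Lam T) (\<lambda>t. f (x, t) - Q (\<lambda>t'. f (x, t')) t))\<^sup>2 \<partial>lebesgue_on A)
      \<le> sqrt (\<integral>x. (approx_defect T N \<epsilon> (\<lambda>t. f (x, t)))\<^sup>2 \<partial>lebesgue_on A)"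
proof (intro real_sqrt_le_mono integral_mono_AE)
  have A': "A \<in> sets borel" using A by (simp add: compact_imp_closed)
  show "integrable (lebesgue_on A) (\<lambda>x. (L2norm (Lam T) (\<lambda>t. f (x, t) - Q (\<lambda>t'. f (x, t')) t))\<^sup>2)"
    using L2space_slices(2)[OF A' Lam_borel slice_error_eq_L2norm(1)[OF T Q A f]] by simp
  show "integrable (lebesgue_on A) (\<lambda>x. (approx_defect T N \<epsilon> (\<lambda>t. f (x, t)))\<^sup>2)"
  proof (rule Bochner_Integration.integrable_bound[OF L2space_slices(2)[OF A' Lam_borel f]])
    show "(\<lambda>x. (approx_defect T N \<epsilon> (\<lambda>t. f (x, t)))\<^sup>2) \<in> borel_measurable (lebesgue_on A)"
      by (intro borel_measurable_power approx_defect_slice_measurable[OF \<epsilon> A f])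
    show "AE x in lebesgue_on A. norm ((approx_defect T N \<epsilon> (\<lambda>t. f (x, t)))\<^sup>2) \<le> norm ((L2norm (Lam T) (\<lambda>t. f (x, t)))\<^sup>2)"
      using approx_defect_le_L2norm[OF \<epsilon>] approx_defect_nonneg[OF \<epsilon>] by (intro AE_I2) (auto intro!: power_mono)
  qed
  show "AE x in lebesgue_on A. (L2norm (Lam T) (\<lambda>t. f (x, t) - Q (\<lambda>t'. f (x, t')) t))\<^sup>2
      \<le> (approx_defect T N \<epsilon> (\<lambda>t. f (x, t)))\<^sup>2"
    using L2space_slices(1)[OF A' Lam_borel f]
  proof eventually_elim
    case (elim x)
    from err[rule_format, OF this] show ?case
      by (rule power_mono) (rule L2norm_nonneg)
  qed
qed

lemma err_y_eq_L2norm: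
  assumes "Ty > 1" "fourier_reconstruction Ty Ny Qy" "g \<in> L2space (Lam Tx \<times> Lam Ty)"
  shows "err_y Tx Ty Qy g = L2norm (Lam Tx \<times> Lam Ty) (\<lambda>z. g z - Qy (\<lambda>s. g (fst z, s)) (snd z))"
  unfolding err_y_def using slice_error_eq_L2norm(2)[OF assms(1,2) Lam_compact assms(3)] .

lemma err_x_eq_L2norm:
  assumes "Tx > 1" "fourier_reconstruction Tx Nx Qx" "g \<circ> prod.swap \<in> L2space (Lam Ty \<times> Lam Tx)"
  shows "err_x Tx Ty Qx g = L2norm (Lam Ty \<times> Lam Tx) (\<lambda>z. (g \<circ> prod.swap) z - Qx (\<lambda>t. (g \<circ> prod.swap) (fst z, t)) (snd z))"
  unfolding err_x_def using slice_error_eq_L2norm(2)[OF assms(1,2) Lam_compact assms(3)] by simp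

text \<open>
  Square integrability holds for every point \<open>s\<close>, and not only for almost every one, because the
  evaluation at \<open>s\<close> is a bounded functional. Hence the outer operator of a tensor product is
  applied to an element of \<open>L\<^sup>2\<close> for each value of the second variable.
\<close>

lemma fourier_reconstruction_evaluated_slices_L2:
  fixes f :: "'a::euclidean_space \<times> real \<Rightarrow> complex"
  assumes T: "T > 1" and Q: "fourier_reconstruction T N Q" and A: "compact A"
    and f: "f \<in> L2space (A \<times> Lam T)" and s: "s \<in> Lam T"
  shows "(\<lambda>x. Q (\<lambda>t. f (x, t)) s) \<in> L2space A"
proof -
  have A': "A \<in> sets borel" using A by (simp add: compact_imp_closed)
  note \<phi> = fourier_reconstruction_functional[OF T Q s]
  have m: "(\<lambda>x. Q (\<lambda>t. f (x, t)) s) \<in> borel_measurable (lebesgue_on A)"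
    by (rule L2_functional_slice_measurable[OF \<phi> Lam_compact A' f])
  obtain C where C: "\<And>v. v \<in> L2space (Lam T) \<Longrightarrow> norm (Q v s) \<le> C * L2norm (Lam T) v"
    using L2_functional_bound[OF \<phi>] by blast
  have "integrable (lebesgue_on A) (\<lambda>x. (norm (Q (\<lambda>t. f (x, t)) s))\<^sup>2)"
  proof (rule Bochner_Integration.integrable_bound)
    show "integrable (lebesgue_on A) (\<lambda>x. C\<^sup>2 * (L2norm (Lam T) (\<lambda>t. f (x, t)))\<^sup>2)"
      using L2space_slices(2)[OF A' Lam_borel f] by simp
    show "AE x in lebesgue_on A. norm ((norm (Q (\<lambda>t. f (x, t)) s))\<^sup>2) \<le> norm (C\<^sup>2 * (L2norm (Lam T) (\<lambda>t. f (x, t)))\<^sup>2)"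
      using L2space_slices(1)[OF A' Lam_borel f]
    proof eventually_elim
      case (elim x)
      from power_mono[OF C[OF elim], of 2] show ?case
        by (simp add: power_mult_distrib)
    qed
  qed (use m in measurable)
  then show ?thesis using m by (simp add: L2space_def)
qed

text \<open>
  Interpolating in the second variable writes the tensor reconstruction as a finite sum of
  products of continuous functions.
\<close>

lemma tensor_op_continuous:
  assumes Tx: "Tx > 1" and Ty: "Ty > 1"
    and Qx: "fourier_reconstruction Tx Nx Qx" and Qy: "fourier_reconstruction Ty Ny Qy"
    and g: "g \<in> L2space (Lam Tx \<times> Lam Ty)"
  shows "continuous_on (Lam Tx \<times> Lam Ty) (tensor_op Qx Qy g)"
proof -
  obtain \<sigma> w where \<sigma>: "\<And>j. j \<le> 2 * Ny \<Longrightarrow> \<sigma> j \<in> Lam Ty" and w: "\<And>j S. continuous_on S (w j :: real \<Rightarrow> complex)"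
    and interp: "\<And>Q v t. fourier_reconstruction Ty Ny Q \<Longrightarrow> v \<in> L2space (Lam Ty) \<Longrightarrow> t \<in> Lam Ty \<Longrightarrow>
        Q v t = (\<Sum>j\<le>2 * Ny. Q v (\<sigma> j) * w j t)"
    using fourier_reconstruction_interpolation[OF Ty, of Ny] by blast
  define V where "V s t = Qy (\<lambda>s'. g (t, s')) s" for s t
  have V: "V s \<in> L2space (Lam Tx)" if "s \<in> Lam Ty" for s
    unfolding V_def by (rule fourier_reconstruction_evaluated_slices_L2[OF Ty Qy Lam_compact g that])
  have rep: "tensor_op Qx Qy g z = (\<Sum>j\<le>2 * Ny. w j (snd z) * Qx (V (\<sigma> j)) (fst z))"
    if z: "z \<in> Lam Tx \<times> Lam Ty" for z
  proof -
    note \<phi> = fourier_reconstruction_functional[OF Tx Qx, of "fst z"]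
    have t: "fst z \<in> Lam Tx" and s: "snd z \<in> Lam Ty" using z by auto
    have "AE t in lebesgue_on (Lam Tx). V (snd z) t = (\<Sum>j\<le>2 * Ny. w j (snd z) * V (\<sigma> j) t)"
      using L2space_slices(1)[OF Lam_borel Lam_borel g]
      by eventually_elim (simp add: V_def interp[OF Qy _ s, of "\<lambda>s'. g (_, s')"] mult.commute)
    from L2_functional_cong_AE[OF \<phi>[OF t] Lam_lebesgue V[OF s] this]
    have "Qx (V (snd z)) (fst z) = Qx (\<lambda>t. \<Sum>j\<le>2 * Ny. w j (snd z) * V (\<sigma> j) t) (fst z)" .
    also have "\<dots> = (\<Sum>j\<le>2 * Ny. Qx (\<lambda>t. w j (snd z) * V (\<sigma> j) t) (fst z))"
      using V \<sigma> by (intro L2_functional_sum[OF \<phi>[OF t]] L2space_mult) auto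
    also have "\<dots> = (\<Sum>j\<le>2 * Ny. w j (snd z) * Qx (V (\<sigma> j)) (fst z))"
      using V \<sigma> by (intro sum.cong refl L2_functional_mult[OF \<phi>[OF t]]) auto
    finally show ?thesis
      by (simp add: tensor_op_def V_def[abs_def] case_prod_beta)
  qed
  have "continuous_on (Lam Tx \<times> Lam Ty) (\<lambda>z. \<Sum>j\<le>2 * Ny. w j (snd z) * Qx (V (\<sigma> j)) (fst z))"
  proof (intro continuous_on_sum continuous_on_mult)
    fix j assume "j \<in> {..2 * Ny}"
    then have Vj: "V (\<sigma> j) \<in> L2space (Lam Tx)" using V \<sigma> by simp
    show "continuous_on (Lam Tx \<times> Lam Ty) (\<lambda>z. w j (snd z))"
      by (intro continuous_on_compose2[OF w[of UNIV]] continuous_intros) auto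
    have op: "L2_linear_op (Lam Tx) (fourier_space Tx Nx) Qx"
      using Qx by (simp add: fourier_reconstruction_def)
    obtain c where c: "\<And>t. t \<in> Lam Tx \<Longrightarrow> Qx (V (\<sigma> j)) t = fourier_synth Nx c t"
      by (rule L2_linear_op_fourier_synthE[OF op Vj]) blast
    have "continuous_on (Lam Tx) (Qx (V (\<sigma> j)))"
      using fourier_synth_continuous[of "Lam Tx" Nx c] c by (simp cong: continuous_on_cong)
    then show "continuous_on (Lam Tx \<times> Lam Ty) (\<lambda>z. Qx (V (\<sigma> j)) (fst z))"
      by (rule continuous_on_compose2) (auto intro!: continuous_intros)
  qed
  then show ?thesis
    by (rule continuous_on_eq) (simp only: rep)
qed

text \<open>
  \<open>g - Qx Qy g = (g - Qx g) + Qx (g - Qy g)\<close>: the first summand is measured by \<open>err_x\<close>, and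
  \<open>Qx\<close> acts on the second slice by slice with norm at most \<open>\<kappa>\<close>.
\<close>

lemma tensor_reconstruction_error:
  assumes Tx: "Tx > 1" and Ty: "Ty > 1"
    and Qx: "fourier_reconstruction Tx Nx Qx" and Qy: "fourier_reconstruction Ty Ny Qy"
    and bound: "\<forall>v\<in>L2space (Lam Tx). L2norm (Lam Tx) (Qx v) \<le> \<kappa> * L2norm (Lam Tx) v" and \<kappa>: "\<kappa> \<ge> 0"
    and g: "g \<in> L2space (Lam Tx \<times> Lam Ty)"
  shows "L2norm (Lam Tx \<times> Lam Ty) (\<lambda>z. g z - tensor_op Qx Qy g z) \<le> err_x Tx Ty Qx g + \<kappa> * err_y Tx Ty Qy g"
proof -
  let ?X = "Lam Tx" and ?Y = "Lam Ty"
  define G where "G = tensor_op Qx Qy g"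
  have G: "G \<in> L2space (?X \<times> ?Y)"
    unfolding G_def by (intro L2space_continuous compact_Times Lam_compact tensor_op_continuous[OF Tx Ty Qx Qy g])
  note swap = L2space_swap[OF Lam_borel Lam_borel]
  define g' where "g' = g \<circ> prod.swap"
  have g': "g' \<in> L2space (?Y \<times> ?X)" unfolding g'_def by (rule swap(2)[OF g])
  define Ey where "Ey = (\<lambda>z. g z - Qy (\<lambda>s. g (fst z, s)) (snd z))"
  have Ey: "Ey \<in> L2space (?X \<times> ?Y)" "L2norm (?X \<times> ?Y) Ey = err_y Tx Ty Qy g"
    using slice_error_eq_L2norm(1)[OF Ty Qy Lam_compact g] err_y_eq_L2norm[OF Ty Qy g]
    by (simp_all add: Ey_def)
  define Ex where "Ex = (\<lambda>z. g' z - Qx (\<lambda>t. g' (fst z, t)) (snd z))"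
  have Ex: "Ex \<in> L2space (?Y \<times> ?X)" "L2norm (?Y \<times> ?X) Ex = err_x Tx Ty Qx g"
    using slice_error_eq_L2norm(1)[OF Tx Qx Lam_compact g'] err_x_eq_L2norm[OF Tx Qx] g'
    by (simp_all add: Ex_def g'_def)
  define W where "W = (\<lambda>z. Qx (\<lambda>t. g' (fst z, t)) (snd z) - (G \<circ> prod.swap) z)"
  have W: "W \<in> L2space (?Y \<times> ?X)"
    unfolding W_def by (intro L2space_diff fourier_reconstruction_slices_L2[OF Tx Qx Lam_compact g'] swap(2) G)
  have "AE s in lebesgue_on ?Y. (\<lambda>t. W (s, t)) \<in> L2space ?X \<and>
      L2norm ?X (\<lambda>t. W (s, t)) \<le> \<kappa> * L2norm ?X (\<lambda>t. (Ey \<circ> prod.swap) (s, t))"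
    using L2space_slices(1)[OF Lam_borel Lam_borel W] L2space_slices(1)[OF Lam_borel Lam_borel g'] AE_space
  proof eventually_elim
    case (elim s)
    then have s: "s \<in> ?Y" by simp
    define v where "v t = Qy (\<lambda>s'. g (t, s')) s" for t
    have v: "v \<in> L2space ?X"
      unfolding v_def by (rule fourier_reconstruction_evaluated_slices_L2[OF Ty Qy Lam_compact g s])
    have e: "(\<lambda>t. (Ey \<circ> prod.swap) (s, t)) = (\<lambda>t. g' (s, t) - v t)"
      by (simp add: Ey_def g'_def v_def)
    have "W (s, t) = Qx (\<lambda>t. g' (s, t) - v t) t" if "t \<in> ?X" for t
      using L2_functional_diff[OF fourier_reconstruction_functional[OF Tx Qx that] elim(2) v]
      by (simp add: W_def G_def tensor_op_def v_def[abs_def])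
    then have "L2norm ?X (\<lambda>t. W (s, t)) = L2norm ?X (Qx (\<lambda>t. g' (s, t) - v t))"
      by (rule L2norm_cong)
    also have "\<dots> \<le> \<kappa> * L2norm ?X (\<lambda>t. g' (s, t) - v t)"
      using bound L2space_diff[OF elim(2) v] by blast
    finally show ?case using elim(1) unfolding e by blast
  qed
  from L2space_from_slices(2)[OF Lam_borel Lam_borel _ swap(2)[OF Ey(1)] \<kappa> this]
  have W_le: "L2norm (?Y \<times> ?X) W \<le> \<kappa> * err_y Tx Ty Qy g"
    using W by (simp only: swap(3)[OF Ey(1)] Ey(2) L2space_def mem_Collect_eq)
  have "L2norm (?X \<times> ?Y) (\<lambda>z. g z - G z) = L2norm (?Y \<times> ?X) ((\<lambda>z. g z - G z) \<circ> prod.swap)"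
    by (rule swap(3)[OF L2space_diff[OF g G], symmetric])
  also have "(\<lambda>z. g z - G z) \<circ> prod.swap = (\<lambda>z. Ex z + W z)"
    by (auto simp: Ex_def W_def g'_def)
  also have "L2norm (?Y \<times> ?X) (\<lambda>z. Ex z + W z) \<le> err_x Tx Ty Qx g + \<kappa> * err_y Tx Ty Qy g"
    using L2norm_triangle[OF Ex(1) W] Ex(2) W_le by simp
  finally show ?thesis by (simp add: G_def)
qed

section \<open>Change of variables on the patch\<close>

lemma L2space_null_difference:
  assumes S: "S \<in> sets lebesgue" and Q: "Q \<in> sets lebesgue" and sub: "S \<subseteq> Q" and null: "Q - S \<in> null_sets lebesgue"
  shows "v \<in> L2space S \<longleftrightarrow> v \<in> L2space Q" and "v \<in> L2space Q \<Longrightarrow> L2norm S v = L2norm Q v"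
proof -
  have AE: "AE x in lebesgue_on Q. x \<in> S"
  proof (subst AE_restrict_space_iff)
    show "AE x in lebesgue. x \<in> Q \<longrightarrow> x \<in> S"
      using AE_not_in[OF null] by eventually_elim auto
  qed (use Q in simp)
  have m: "v \<in> borel_measurable (lebesgue_on S) \<longleftrightarrow> v \<in> borel_measurable (lebesgue_on Q)"
  proof
    assume "v \<in> borel_measurable (lebesgue_on S)"
    then have "(\<lambda>x. if x \<in> S then v x else 0) \<in> borel_measurable (lebesgue_on Q)"
      using borel_measurable_if_lebesgue_on[OF S Q sub] by blast
    then show "v \<in> borel_measurable (lebesgue_on Q)"
      by (rule borel_measurable_lebesgue_on_cong_AE[OF Q]) (use AE in \<open>auto elim!: eventually_mono\<close>)
  next
    assume "v \<in> borel_measurable (lebesgue_on Q)"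
    then show "v \<in> borel_measurable (lebesgue_on S)"
      by (rule measurable_restrict_mono[OF _ sub])
  qed
  have "AE x in lebesgue. indicator S x = (indicator Q x :: ennreal)"
    using AE_not_in[OF null] by eventually_elim (use sub in \<open>auto simp: indicator_def\<close>)
  then have n: "(\<integral>\<^sup>+x. ennreal ((norm (v x))\<^sup>2) \<partial>lebesgue_on S) = (\<integral>\<^sup>+x. ennreal ((norm (v x))\<^sup>2) \<partial>lebesgue_on Q)"
    using S Q by (simp add: nn_integral_restrict_space) (intro nn_integral_cong_AE, auto elim!: eventually_mono)
  show iff: "v \<in> L2space S \<longleftrightarrow> v \<in> L2space Q"
    unfolding L2space_iff_nn_integral m n ..
  show "L2norm S v = L2norm Q v" if "v \<in> L2space Q"
  proof -
    have "ennreal ((L2norm S v)\<^sup>2) = ennreal ((L2norm Q v)\<^sup>2)"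
      using n that iff by (simp add: nn_integral_eq_L2norm)
    then show ?thesis by (simp add: L2norm_nonneg)
  qed
qed

lemma absolutely_integrable_on_iff_integrable_lebesgue_on:
  fixes f :: "'a::euclidean_space \<Rightarrow> 'b::euclidean_space"
  assumes "S \<in> sets lebesgue"
  shows "f absolutely_integrable_on S \<longleftrightarrow> integrable (lebesgue_on S) f"
  using assms by (simp add: set_integrable_def integrable_restrict_space)

lemma integrable_change_of_variables:
  fixes u :: "real^'n::{finite,wellorder} \<Rightarrow> real" and \<Psi> :: "real^'n::_ \<Rightarrow> real^'n::_"
  assumes S: "S \<in> sets lebesgue" and \<Psi>S: "\<Psi> ` S \<in> sets lebesgue"
    and der: "\<And>x. x \<in> S \<Longrightarrow> (\<Psi> has_derivative D x) (at x within S)"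
    and inj: "inj_on \<Psi> S" and u: "integrable (lebesgue_on (\<Psi> ` S)) u"
  shows "integrable (lebesgue_on S) (\<lambda>x. \<bar>det (matrix (D x))\<bar> * u (\<Psi> x))"
    and "(\<integral>x. \<bar>det (matrix (D x))\<bar> * u (\<Psi> x) \<partial>lebesgue_on S) = (\<integral>y. u y \<partial>lebesgue_on (\<Psi> ` S))"
proof -
  have u': "u absolutely_integrable_on \<Psi> ` S"
    using u by (simp add: absolutely_integrable_on_iff_integrable_lebesgue_on[OF \<Psi>S])
  have *: "(\<lambda>x. \<bar>det (matrix (D x))\<bar> * u (\<Psi> x)) absolutely_integrable_on S \<and>
      integral S (\<lambda>x. \<bar>det (matrix (D x))\<bar> * u (\<Psi> x)) = integral (\<Psi> ` S) u"
    using has_absolute_integral_change_of_variables[OF S der inj, of "\<lambda>x. vec (u x) :: real^1" "vec (integral (\<Psi> ` S) u)"] u'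
    unfolding absolutely_integrable_on_1_iff integral_on_1_eq by (simp add: o_def)
  then show i: "integrable (lebesgue_on S) (\<lambda>x. \<bar>det (matrix (D x))\<bar> * u (\<Psi> x))"
    by (simp add: absolutely_integrable_on_iff_integrable_lebesgue_on[OF S])
  show "(\<integral>x. \<bar>det (matrix (D x))\<bar> * u (\<Psi> x) \<partial>lebesgue_on S) = (\<integral>y. u y \<partial>lebesgue_on (\<Psi> ` S))"
    using * lebesgue_integral_eq_integral[OF i S] lebesgue_integral_eq_integral[OF u \<Psi>S] by simp
qed

text \<open>
  Measurability of \<open>v \<circ> \<Psi>\<close> is read off from the change of variables formula itself: both
  \<open>\<bar>det D\<bar> * (v \<circ> \<Psi>)\<close> and, with the constant function 1, \<open>\<bar>det D\<bar>\<close> are integrable, and the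
  lower bound on the determinant allows the division.
\<close>

lemma L2space_pullback:
  fixes \<Psi> :: "real^'n::{finite,wellorder} \<Rightarrow> real^'n::_" and v :: "real^'n::_ \<Rightarrow> complex"
  assumes S: "S \<in> sets lebesgue" and \<Psi>S: "\<Psi> ` S \<in> lmeasurable"
    and der: "\<And>x. x \<in> S \<Longrightarrow> (\<Psi> has_derivative D x) (at x within S)"
    and inj: "inj_on \<Psi> S" and Jmin: "0 < Jmin"
    and J: "\<And>x. x \<in> S \<Longrightarrow> Jmin \<le> \<bar>det (matrix (D x))\<bar> \<and> \<bar>det (matrix (D x))\<bar> \<le> Jmax"
    and Jmax: "0 \<le> Jmax"
    and v: "v \<in> L2space (\<Psi> ` S)"
  shows "v \<circ> \<Psi> \<in> L2space S" and "L2norm (\<Psi> ` S) v \<le> sqrt Jmax * L2norm S (v \<circ> \<Psi>)"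
proof -
  have \<Psi>S': "\<Psi> ` S \<in> sets lebesgue" using \<Psi>S by (simp add: fmeasurableD)
  have cov: "integrable (lebesgue_on S) (\<lambda>x. \<bar>det (matrix (D x))\<bar> * u (\<Psi> x))"
    "(\<integral>x. \<bar>det (matrix (D x))\<bar> * u (\<Psi> x) \<partial>lebesgue_on S) = (\<integral>y. u y \<partial>lebesgue_on (\<Psi> ` S))"
    if "integrable (lebesgue_on (\<Psi> ` S)) u" for u
    using integrable_change_of_variables[OF S \<Psi>S' der inj that] by auto
  have [measurable]: "v \<in> borel_measurable (lebesgue_on (\<Psi> ` S))"
    and v2: "integrable (lebesgue_on (\<Psi> ` S)) (\<lambda>x. (norm (v x))\<^sup>2)"
    using v by (auto simp: L2space_def)
  have one: "integrable (lebesgue_on (\<Psi> ` S)) (\<lambda>x. 1 :: real)"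
    using \<Psi>S by (auto simp: integrable_restrict_space fmeasurableD lmeasurable_iff_integrable)
  have v1: "integrable (lebesgue_on (\<Psi> ` S)) w"
    if [measurable]: "w \<in> borel_measurable (lebesgue_on (\<Psi> ` S))" and w: "\<And>x. \<bar>w x\<bar> \<le> norm (v x)" for w :: "_ \<Rightarrow> real"
  proof (rule Bochner_Integration.integrable_bound)
    show "integrable (lebesgue_on (\<Psi> ` S)) (\<lambda>x. 1 + (norm (v x))\<^sup>2)"
      using one v2 by simp
    show "AE x in lebesgue_on (\<Psi> ` S). norm (w x) \<le> norm (1 + (norm (v x))\<^sup>2)"
    proof (rule AE_I2)
      fix x
      have "0 \<le> (norm (v x) - 1 / 2)\<^sup>2" by simp
      then have "norm (v x) \<le> 1 + (norm (v x))\<^sup>2"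
        by (simp add: power2_diff power_divide)
      then show "norm (w x) \<le> norm (1 + (norm (v x))\<^sup>2)"
        using w[of x] by simp
    qed
  qed measurable
  have d[measurable]: "(\<lambda>x. \<bar>det (matrix (D x))\<bar>) \<in> borel_measurable (lebesgue_on S)"
    using cov(1)[OF one] by (simp add: borel_measurable_integrable)
  have re: "(\<lambda>x. \<bar>det (matrix (D x))\<bar> * w (\<Psi> x) / \<bar>det (matrix (D x))\<bar>) \<in> borel_measurable (lebesgue_on S)"
    if "w \<in> borel_measurable (lebesgue_on (\<Psi> ` S))" "\<And>x. \<bar>w x\<bar> \<le> norm (v x)" for w
    by (intro borel_measurable_divide d borel_measurable_integrable[OF cov(1)[OF v1[OF that]]])
  have comp: "(\<lambda>x. w (\<Psi> x)) \<in> borel_measurable (lebesgue_on S)"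
    if "w \<in> borel_measurable (lebesgue_on (\<Psi> ` S))" "\<And>x. \<bar>w x\<bar> \<le> norm (v x)" for w
  proof (rule borel_measurable_lebesgue_on_cong_AE[OF S re[OF that]])
    show "AE x in lebesgue_on S. \<bar>det (matrix (D x))\<bar> * w (\<Psi> x) / \<bar>det (matrix (D x))\<bar> = w (\<Psi> x)"
    proof (rule AE_I2)
      fix x assume "x \<in> space (lebesgue_on S)"
      then have "Jmin \<le> \<bar>det (matrix (D x))\<bar>" using J[of x] by simp
      then have "\<bar>det (matrix (D x))\<bar> > 0" using Jmin by linarith
      then show "\<bar>det (matrix (D x))\<bar> * w (\<Psi> x) / \<bar>det (matrix (D x))\<bar> = w (\<Psi> x)" by simp
    qed
  qed
  have "(\<lambda>x. Re (v (\<Psi> x))) \<in> borel_measurable (lebesgue_on S)"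
    by (intro comp) (auto simp: abs_Re_le_cmod)
  moreover have "(\<lambda>x. Im (v (\<Psi> x))) \<in> borel_measurable (lebesgue_on S)"
    by (intro comp) (auto simp: abs_Im_le_cmod)
  ultimately have vm: "v \<circ> \<Psi> \<in> borel_measurable (lebesgue_on S)"
    by (simp add: borel_measurable_complex_iff)
  have i: "integrable (lebesgue_on S) (\<lambda>x. (norm ((v \<circ> \<Psi>) x))\<^sup>2)"
  proof (rule Bochner_Integration.integrable_bound)
    show "integrable (lebesgue_on S) (\<lambda>x. (1 / Jmin) * (\<bar>det (matrix (D x))\<bar> * (norm (v (\<Psi> x)))\<^sup>2))"
      using cov(1)[OF v2] by (intro integrable_mult_right)
    show "AE x in lebesgue_on S. norm ((norm ((v \<circ> \<Psi>) x))\<^sup>2) \<le> norm ((1 / Jmin) * (\<bar>det (matrix (D x))\<bar> * (norm (v (\<Psi> x)))\<^sup>2))"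
    proof (rule AE_I2)
      fix x assume "x \<in> space (lebesgue_on S)"
      then have "Jmin * (norm (v (\<Psi> x)))\<^sup>2 \<le> \<bar>det (matrix (D x))\<bar> * (norm (v (\<Psi> x)))\<^sup>2"
        using J[of x] by (intro mult_right_mono) auto
      then show "norm ((norm ((v \<circ> \<Psi>) x))\<^sup>2) \<le> norm ((1 / Jmin) * (\<bar>det (matrix (D x))\<bar> * (norm (v (\<Psi> x)))\<^sup>2))"
        using Jmin by (simp add: abs_mult pos_le_divide_eq mult.commute)
    qed
  qed (use vm in measurable)
  show v\<Psi>: "v \<circ> \<Psi> \<in> L2space S" using vm i by (simp add: L2space_def)
  have "(L2norm (\<Psi> ` S) v)\<^sup>2 = (\<integral>x. \<bar>det (matrix (D x))\<bar> * (norm (v (\<Psi> x)))\<^sup>2 \<partial>lebesgue_on S)"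
    unfolding L2norm_square using cov(2)[OF v2] by simp
  also have "\<dots> \<le> (\<integral>x. Jmax * (norm ((v \<circ> \<Psi>) x))\<^sup>2 \<partial>lebesgue_on S)"
    using i cov(1)[OF v2] J by (intro integral_mono) (auto intro!: mult_right_mono)
  also have "\<dots> = (sqrt Jmax * L2norm S (v \<circ> \<Psi>))\<^sup>2"
    using Jmax by (simp add: power_mult_distrib L2norm_square)
  finally show "L2norm (\<Psi> ` S) v \<le> sqrt Jmax * L2norm S (v \<circ> \<Psi>)"
    using Jmax by (rule_tac power2_le_imp_le) (auto simp: L2norm_nonneg)
qed

section \<open>The affine rescaling\<close>

lemma square_to_Lam_inverse:
  assumes "h \<noteq> 0" "Tx \<noteq> 0" "Ty \<noteq> 0"
  shows "Lam_to_square a h Tx Ty (square_to_Lam a h Tx Ty p) = p"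
    and "square_to_Lam a h Tx Ty (Lam_to_square a h Tx Ty z) = z"
  using assms by (auto simp: Lam_to_square_def square_to_Lam_def vec_eq_iff forall_2 vector_2 prod_eq_iff)

lemma Lam_to_square_vimage_box:
  assumes "h > 0" "Tx > 0" "Ty > 0"
  shows "Lam_to_square a h Tx Ty -` box l u = box (square_to_Lam a h Tx Ty l) (square_to_Lam a h Tx Ty u)"
    and "Lam_to_square a h Tx Ty -` cbox l u = cbox (square_to_Lam a h Tx Ty l) (square_to_Lam a h Tx Ty u)"
proof -
  have lt: "x < c + h * y / (2 * pi / T) \<longleftrightarrow> (x - c) / h * (2 * pi / T) < y"
    and gt: "c + h * y / (2 * pi / T) < x \<longleftrightarrow> y < (x - c) / h * (2 * pi / T)"
    if "T > 0" for x y c T :: real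
  proof -
    define r where "r = 2 * pi / T"
    have r: "r > 0" using that by (simp add: r_def)
    show "x < c + h * y / (2 * pi / T) \<longleftrightarrow> (x - c) / h * (2 * pi / T) < y"
      "c + h * y / (2 * pi / T) < x \<longleftrightarrow> y < (x - c) / h * (2 * pi / T)"
      unfolding r_def[symmetric] using r assms(1) by (simp_all add: field_simps)
  qed
  have le: "x \<le> c + h * y / (2 * pi / T) \<longleftrightarrow> (x - c) / h * (2 * pi / T) \<le> y"
    and ge: "c + h * y / (2 * pi / T) \<le> x \<longleftrightarrow> y \<le> (x - c) / h * (2 * pi / T)"
    if "T > 0" for x y c T :: real
    using lt[OF that, of x c y] gt[OF that, of c y x] by (auto simp: not_less[symmetric])
  show "Lam_to_square a h Tx Ty -` box l u = box (square_to_Lam a h Tx Ty l) (square_to_Lam a h Tx Ty u)"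
    using lt[OF assms(2)] gt[OF assms(2)] lt[OF assms(3)] gt[OF assms(3)]
    by (auto simp: Lam_to_square_def square_to_Lam_def mem_box_cart forall_2 vector_2 mem_box Basis_prod_def)
  show "Lam_to_square a h Tx Ty -` cbox l u = cbox (square_to_Lam a h Tx Ty l) (square_to_Lam a h Tx Ty u)"
    using le[OF assms(2)] ge[OF assms(2)] le[OF assms(3)] ge[OF assms(3)]
    by (auto simp: Lam_to_square_def square_to_Lam_def mem_box_cart forall_2 vector_2 mem_box Basis_prod_def)
qed

text \<open>
  Lebesgue measure on the plane is determined by its values on boxes, and the affine map sends
  boxes to boxes with the side lengths scaled.
\<close>

lemma lborel_Lam_to_square:
  assumes h: "h > 0" and T: "Tx > 0" "Ty > 0"
  shows "lborel = density (distr lborel borel (Lam_to_square a h Tx Ty))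
                    (\<lambda>_. ennreal ((h / (2 * pi / Tx)) * (h / (2 * pi / Ty))))" (is "_ = density (distr _ _ ?\<phi>) (\<lambda>_. ennreal ?c)")
    and "Lam_to_square a h Tx Ty \<in> borel_measurable borel"
proof -
  have \<phi>: "?\<phi> = (\<lambda>z. \<chi> i. if i = 1 then a$1 + h * fst z / (2 * pi / Tx) else a$2 + h * snd z / (2 * pi / Ty))"
    by (auto simp: Lam_to_square_def vec_eq_iff forall_2 vector_2)
  have cont: "continuous_on UNIV ?\<phi>"
    unfolding \<phi>
  proof (rule continuous_on_vec_lambda)
    fix i :: 2
    show "continuous_on UNIV (\<lambda>z. if i = 1 then a$1 + h * fst z / (2 * pi / Tx) else a$2 + h * snd z / (2 * pi / Ty))"
      using T by (cases "i = 1") (auto intro!: continuous_intros)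
  qed
  then show m: "?\<phi> \<in> borel_measurable borel"
    by (rule borel_measurable_continuous_onI)
  have c: "?c \<ge> 0" using h T by simp
  have basis2: "(Basis :: (real^2) set) = {axis 1 1, axis 2 1}"
    by (auto simp: Basis_vec_def UNIV_2)
  show "lborel = density (distr lborel borel ?\<phi>) (\<lambda>_. ennreal ?c)"
  proof (rule lborel_eqI)
    fix l u :: "real^2" assume lu: "\<And>b. b \<in> Basis \<Longrightarrow> l \<bullet> b \<le> u \<bullet> b"
    have lu': "l$1 \<le> u$1" "l$2 \<le> u$2"
      using lu[of "axis 1 1"] lu[of "axis 2 1"] by (auto simp: basis2 inner_axis)
    define x y where "x = (u$1 - l$1) / h * (2 * pi / Tx)" and "y = (u$2 - l$2) / h * (2 * pi / Ty)"
    have xy: "x \<ge> 0" "y \<ge> 0" using lu' h T by (simp_all add: x_def y_def)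
    have cxy: "?c * (x * y) = (u$1 - l$1) * (u$2 - l$2)"
      using h T by (simp add: x_def y_def)
    let ?\<psi> = "square_to_Lam a h Tx Ty"
    have d: "fst (?\<psi> u) - fst (?\<psi> l) = x" "snd (?\<psi> u) - snd (?\<psi> l) = y"
      by (simp_all add: square_to_Lam_def x_def y_def diff_divide_distrib left_diff_distrib)
    have "emeasure (density (distr lborel borel ?\<phi>) (\<lambda>_. ennreal ?c)) (box l u)
        = ennreal ?c * emeasure lborel (?\<phi> -` box l u)"
      using m by (subst emeasure_density_const) (simp_all add: emeasure_distr)
    also have "?\<phi> -` box l u = box (?\<psi> l) (?\<psi> u)"
      by (rule Lam_to_square_vimage_box(1)[OF h T])
    also have "emeasure lborel (box (?\<psi> l) (?\<psi> u)) = ennreal (x * y)"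
    proof -
      have "emeasure lborel (box (?\<psi> l) (?\<psi> u)) = ennreal (\<Prod>b\<in>Basis. (?\<psi> u - ?\<psi> l) \<bullet> b)"
        using d xy by (intro emeasure_lborel_box) (auto simp: Basis_prod_def inner_prod_def)
      also have "(\<Prod>b\<in>Basis. (?\<psi> u - ?\<psi> l) \<bullet> b) = x * y"
        using d by (simp add: Basis_prod_def inner_prod_def)
      finally show ?thesis .
    qed
    also have "ennreal ?c * ennreal (x * y) = ennreal (?c * (x * y))"
      using c by (rule ennreal_mult'[symmetric])
    also have "\<dots> = ennreal (\<Prod>b\<in>Basis. (u - l) \<bullet> b)"
      unfolding cxy by (simp add: basis2 axis_eq_axis inner_axis)
    finally show "emeasure (density (distr lborel borel ?\<phi>) (\<lambda>_. ennreal ?c)) (box l u) = ennreal (\<Prod>b\<in>Basis. (u - l) \<bullet> b)" .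
  qed simp
qed

lemma ref_square_eq_cbox: "ref_square a h = cbox a (\<chi> i. a $ i + h)"
  by (auto simp: ref_square_def mem_box_cart forall_2)

lemma Lam_to_square_vimage_ref_square:
  assumes "h > 0" "Tx > 0" "Ty > 0"
  shows "Lam_to_square a h Tx Ty -` ref_square a h = Lam Tx \<times> Lam Ty"
  unfolding ref_square_eq_cbox Lam_to_square_vimage_box(2)[OF assms] using assms
  by (auto simp: square_to_Lam_def Lam_def cbox_Pair_eq)

lemma L2_Lam_to_square:
  assumes h: "h > 0" and T: "Tx > 0" "Ty > 0"
    and v: "v \<in> L2space (ref_square a h)"
  defines "\<rho> \<equiv> measure lebesgue (ref_square a h) / measure lebesgue (Lam Tx \<times> Lam Ty)"
  shows "v \<circ> Lam_to_square a h Tx Ty \<in> L2space (Lam Tx \<times> Lam Ty)"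
    and "L2norm (ref_square a h) v = sqrt \<rho> * L2norm (Lam Tx \<times> Lam Ty) (v \<circ> Lam_to_square a h Tx Ty)"
proof -
  let ?\<phi> = "Lam_to_square a h Tx Ty" and ?Q = "ref_square a h" and ?\<Lambda> = "Lam Tx \<times> Lam Ty"
  define c where "c = (h / (2 * pi / Tx)) * (h / (2 * pi / Ty))"
  have c: "c > 0" using h T by (simp add: c_def)
  note leb = lborel_Lam_to_square(1)[OF h T, of a, folded c_def]
  note m[measurable] = lborel_Lam_to_square(2)[OF h T, of a]
  note vim = Lam_to_square_vimage_ref_square[OF h T, of a]
  have Q: "?Q \<in> sets borel" by (simp add: ref_square_eq_cbox)
  have \<Lambda>: "?\<Lambda> \<in> sets borel" by (intro borel_Times Lam_borel)
  have "emeasure lborel ?Q = emeasure (density (distr lborel borel ?\<phi>) (\<lambda>_. ennreal c)) ?Q"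
    using leb by (rule arg_cong)
  also have "\<dots> = ennreal c * emeasure lborel ?\<Lambda>"
    using Q m by (simp add: emeasure_density_const emeasure_distr vim)
  finally have mQ: "measure lebesgue ?Q = c * measure lebesgue ?\<Lambda>"
    using c Q \<Lambda> by (simp add: measure_def enn2real_mult)
  have "emeasure lborel ?\<Lambda> = emeasure lborel (Lam Tx) * emeasure lborel (Lam Ty)"
    unfolding lborel_prod[symmetric] by (intro lborel.emeasure_pair_measure_Times) (simp_all add: Lam_borel)
  then have "measure lebesgue ?\<Lambda> = (2 * pi / Tx) * (2 * pi / Ty)"
    using T \<Lambda> by (simp add: measure_def Lam_def enn2real_mult)
  then have \<rho>: "\<rho> = c"
    using T by (simp add: \<rho>_def mQ)
  have vm: "v \<in> borel_measurable (lebesgue_on ?Q)" using v by (simp add: L2space_def)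
  have "(\<lambda>x. if x \<in> ?Q then v x else 0) \<in> borel_measurable lebesgue"
    using vm Q by (subst borel_measurable_if) auto
  then obtain w where w: "w \<in> borel_measurable lborel"
    and eq: "AE x in lborel. (if x \<in> ?Q then v x else 0) = w x"
    using completion_ex_borel_measurable_complex by blast
  have [measurable]: "w \<in> borel_measurable borel" using w by simp
  have "AE x in density (distr lborel borel ?\<phi>) (\<lambda>_. ennreal c). (if x \<in> ?Q then v x else 0) = w x"
    using eq by (subst leb[symmetric])
  then have "AE x in distr lborel borel ?\<phi>. (if x \<in> ?Q then v x else 0) = w x"
    using c by (subst (asm) AE_density) auto
  then have "AE z in lborel. (if ?\<phi> z \<in> ?Q then v (?\<phi> z) else 0) = w (?\<phi> z)"
    by (rule AE_distrD[rotated]) (simp add: m)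
  then have eq2: "AE z in lborel. (if z \<in> ?\<Lambda> then (v \<circ> ?\<phi>) z else 0) = w (?\<phi> z)"
    by eventually_elim (auto simp: vim[symmetric] split: if_splits)
  have "AE z in lebesgue_on ?\<Lambda>. w (?\<phi> z) = (v \<circ> ?\<phi>) z"
    using \<Lambda> eq2 by (auto simp: AE_restrict_space_iff AE_completion_iff elim!: eventually_mono)
  moreover have "(\<lambda>z. w (?\<phi> z)) \<in> borel_measurable (lebesgue_on ?\<Lambda>)"
    by (intro measurable_restrict_space1 measurable_completion) simp
  ultimately have vm2: "v \<circ> ?\<phi> \<in> borel_measurable (lebesgue_on ?\<Lambda>)"
    using borel_measurable_lebesgue_on_cong_AE[of ?\<Lambda> "\<lambda>z. w (?\<phi> z)" "v \<circ> ?\<phi>"] \<Lambda> by simp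
  have "(\<integral>\<^sup>+x. ennreal ((norm (v x))\<^sup>2) \<partial>lebesgue_on ?Q) = (\<integral>\<^sup>+x. ennreal ((norm (w x))\<^sup>2) \<partial>lborel)"
    unfolding nn_integral_lebesgue_on_borel[OF Q]
    by (rule nn_integral_cong_AE, use eq in eventually_elim) (auto simp: indicator_def split: if_splits)
  also have "\<dots> = (\<integral>\<^sup>+x. ennreal ((norm (w x))\<^sup>2) \<partial>density (distr lborel borel ?\<phi>) (\<lambda>_. ennreal c))"
    by (subst leb) simp
  also have "\<dots> = ennreal c * (\<integral>\<^sup>+z. ennreal ((norm (w (?\<phi> z)))\<^sup>2) \<partial>lborel)"
    using c by (simp add: nn_integral_density nn_integral_cmult nn_integral_distr m)
  also have "(\<integral>\<^sup>+z. ennreal ((norm (w (?\<phi> z)))\<^sup>2) \<partial>lborel) = (\<integral>\<^sup>+z. ennreal ((norm ((v \<circ> ?\<phi>) z))\<^sup>2) \<partial>lebesgue_on ?\<Lambda>)"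
    unfolding nn_integral_lebesgue_on_borel[OF \<Lambda>]
    by (rule nn_integral_cong_AE, use eq2 in eventually_elim) (auto simp: indicator_def split: if_splits)
  finally have nn: "(\<integral>\<^sup>+x. ennreal ((norm (v x))\<^sup>2) \<partial>lebesgue_on ?Q)
      = ennreal c * (\<integral>\<^sup>+z. ennreal ((norm ((v \<circ> ?\<phi>) z))\<^sup>2) \<partial>lebesgue_on ?\<Lambda>)" .
  show v2: "v \<circ> ?\<phi> \<in> L2space ?\<Lambda>"
    using v vm2 nn c unfolding L2space_iff_nn_integral by (auto simp: ennreal_mult_less_top)
  have "ennreal ((L2norm ?Q v)\<^sup>2) = ennreal ((sqrt c * L2norm ?\<Lambda> (v \<circ> ?\<phi>))\<^sup>2)"
    using nn c unfolding nn_integral_eq_L2norm[OF v] nn_integral_eq_L2norm[OF v2]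
    by (simp add: power_mult_distrib ennreal_mult)
  then have "L2norm ?Q v = sqrt c * L2norm ?\<Lambda> (v \<circ> ?\<phi>)"
    using c by (simp add: L2norm_nonneg)
  then show "L2norm ?Q v = sqrt \<rho> * L2norm ?\<Lambda> (v \<circ> ?\<phi>)"
    by (simp only: \<rho>)
qed

section \<open>Transport to the physical patch\<close>

lemma negligible_lipschitz_image:
  fixes F :: "'a::euclidean_space \<Rightarrow> 'a"
  assumes "L-lipschitz_on S F" "negligible S"
  shows "negligible (F ` S)"
proof (rule negligible_locally_Lipschitz_image[OF _ assms(2)])
  fix x assume "x \<in> S"
  then show "\<exists>U B. open U \<and> x \<in> U \<and> (\<forall>y\<in>S \<inter> U. norm (F y - F x) \<le> B * norm (y - x))"
    using lipschitz_onD[OF assms(1)] by (intro exI[of _ UNIV] exI[of _ L]) (auto simp: dist_norm)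
qed simp

text \<open>
  The exceptional null set of the derivative is removed first. Its image is a null set because
  \<open>\<Psi>\<close> is Lipschitz, so the norms on both sides do not change.
\<close>

lemma L2space_bi_lipschitz_pullback:
  fixes \<Psi> :: "real^'n::{finite,wellorder} \<Rightarrow> real^'n::_"
  assumes Q: "compact Q" "\<not> negligible Q" and bilip: "bi_lipschitz_on Q \<Psi>" and Jmin: "0 < Jmin"
    and jac: "AE q in lebesgue_on Q. (\<Psi> has_derivative D q) (at q within Q) \<and>
          Jmin \<le> \<bar>det (matrix (D q))\<bar> \<and> \<bar>det (matrix (D q))\<bar> \<le> Jmax"
    and v: "v \<in> L2space (\<Psi> ` Q)"
  shows "0 \<le> Jmax" and "v \<circ> \<Psi> \<in> L2space Q" and "L2norm (\<Psi> ` Q) v \<le> sqrt Jmax * L2norm Q (v \<circ> \<Psi>)"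
proof -
  obtain L where inj: "inj_on \<Psi> Q" and L: "L-lipschitz_on Q \<Psi>"
    using bilip unfolding bi_lipschitz_on_def by blast
  have Q': "Q \<in> sets lebesgue" using Q by (simp add: lmeasurable_compact fmeasurableD)
  have P: "\<Psi> ` Q \<in> lmeasurable"
    using Q lipschitz_on_continuous_on[OF L] by (intro lmeasurable_compact compact_continuous_image)
  define S where "S = {q \<in> Q. (\<Psi> has_derivative D q) (at q within Q) \<and>
          Jmin \<le> \<bar>det (matrix (D q))\<bar> \<and> \<bar>det (matrix (D q))\<bar> \<le> Jmax}"
  have SQ: "S \<subseteq> Q" by (auto simp: S_def)
  have "AE q in lebesgue_on Q. q \<in> S"
    using jac AE_space by eventually_elim (simp add: S_def)
  then have "AE q in lebesgue. q \<in> Q \<longrightarrow> q \<in> S"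
    using Q' by (simp add: AE_restrict_space_iff)
  then have "{q \<in> space lebesgue. \<not> (q \<in> Q \<longrightarrow> q \<in> S)} \<in> null_sets lebesgue"
    by (simp only: completion.AE_iff_null_sets)
  moreover have "{q \<in> space lebesgue. \<not> (q \<in> Q \<longrightarrow> q \<in> S)} = Q - S" by auto
  ultimately have null: "Q - S \<in> null_sets lebesgue" by simp
  have S: "S \<in> sets lebesgue"
  proof -
    have "S = Q - (Q - S)" using SQ by auto
    then show ?thesis using Q' null by (metis null_setsD2 sets.Diff)
  qed
  have nullP: "\<Psi> ` Q - \<Psi> ` S \<in> null_sets lebesgue"
  proof -
    have "negligible (\<Psi> ` (Q - S))"
      using null by (intro negligible_lipschitz_image[OF lipschitz_on_subset[OF L]]) (auto simp: negligible_iff_null_sets)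
    moreover have "\<Psi> ` Q - \<Psi> ` S = \<Psi> ` (Q - S)"
      using inj_on_image_set_diff[OF inj, of Q S] SQ by auto
    ultimately show ?thesis by (simp add: negligible_iff_null_sets)
  qed
  have \<Psi>S: "\<Psi> ` S \<in> lmeasurable"
  proof -
    have "\<Psi> ` S = \<Psi> ` Q - (\<Psi> ` Q - \<Psi> ` S)" using SQ by auto
    then show ?thesis using P nullP by (metis fmeasurable_Diff null_setsD2)
  qed
  have "S \<noteq> {}"
    using Q(2) null by (auto simp: negligible_iff_null_sets)
  then show Jmax: "0 \<le> Jmax" using Jmin by (auto simp: S_def)
  have der: "(\<Psi> has_derivative D x) (at x within S)" if "x \<in> S" for x
    using that SQ by (auto simp: S_def intro: has_derivative_subset)
  have bounds: "Jmin \<le> \<bar>det (matrix (D x))\<bar> \<and> \<bar>det (matrix (D x))\<bar> \<le> Jmax" if "x \<in> S" for x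
    using that by (simp add: S_def)
  have vP: "v \<in> L2space (\<Psi> ` S)" "L2norm (\<Psi> ` S) v = L2norm (\<Psi> ` Q) v"
    using L2space_null_difference[of "\<Psi> ` S" "\<Psi> ` Q" v] v \<Psi>S P nullP SQ by (auto simp: fmeasurableD)
  note pull = L2space_pullback[OF S \<Psi>S der inj_on_subset[OF inj SQ] Jmin bounds Jmax vP(1)]
  show "v \<circ> \<Psi> \<in> L2space Q"
    using pull(1) L2space_null_difference(1)[OF S Q' SQ null] by blast
  then show "L2norm (\<Psi> ` Q) v \<le> sqrt Jmax * L2norm Q (v \<circ> \<Psi>)"
    using pull(2) vP(2) L2space_null_difference(2)[OF S Q' SQ null, of "v \<circ> \<Psi>"] by simp
qed

lemma square_to_Lam_continuous: "continuous_on S (square_to_Lam a h Tx Ty)"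
  unfolding square_to_Lam_def[abs_def] divide_inverse by (intro continuous_intros)

text \<open>
  Apply the bound to the constant function 1, whose norm is positive.
\<close>

lemma Lam_operator_bound_nonneg:
  assumes T: "T > 1"
    and bound: "\<forall>v\<in>L2space (Lam T). L2norm (Lam T) (Q v) \<le> \<kappa> * L2norm (Lam T) v"
  shows "0 \<le> \<kappa>"
proof -
  have one: "(\<lambda>t. 1) \<in> L2space (Lam T)" by (intro L2space_continuous Lam_compact) auto
  have "(L2norm (Lam T) (\<lambda>t. 1))\<^sup>2 = measure lebesgue (Lam T)"
    unfolding L2norm_square using Lam_lebesgue[of T] by (simp add: measure_restrict_space)
  also have "\<dots> > 0" using T by (simp add: Lam_def)
  finally have "L2norm (Lam T) (\<lambda>t. 1) > 0"
    using L2norm_nonneg[of "Lam T" "\<lambda>t. 1"] by (simp add: less_le)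
  moreover have "0 \<le> \<kappa> * L2norm (Lam T) (\<lambda>t. 1)"
    using bound one L2norm_nonneg[of "Lam T" "Q (\<lambda>t. 1)"] by fastforce
  ultimately show ?thesis by (simp add: zero_le_mult_iff)
qed

theorem theorem3p3:
  fixes Tx Ty \<epsilon> \<kappa>x Jmin Jmax h :: real
    and Nx Ny :: nat
    and Qx Qy :: "(real \<Rightarrow> complex) \<Rightarrow> real \<Rightarrow> complex"
    and a :: "real^2"
    and P Qhat :: "(real^2) set"
    and \<Psi> :: "real^2 \<Rightarrow> real^2"
    and D\<Psi> :: "real^2 \<Rightarrow> real^2 \<Rightarrow> real^2"
    and f F\<^sub>P :: "real^2 \<Rightarrow> complex"
    and g\<^sub>P G\<^sub>P :: "real \<times> real \<Rightarrow> complex"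
    and \<rho> :: real
  assumes "Tx > 1" and "Ty > 1" and "\<epsilon> > 0"
    and Qx_op: "L2_linear_op (Lam Tx) (fourier_space Tx Nx) Qx"
    and Qy_op: "L2_linear_op (Lam Ty) (fourier_space Ty Ny) Qy"
    and Qx_err: "\<forall>v\<in>L2space (Lam Tx).
          L2norm (Lam Tx) (\<lambda>t. v t - Qx v t) \<le> approx_defect Tx Nx \<epsilon> v"
    and Qy_err: "\<forall>w\<in>L2space (Lam Ty).
          L2norm (Lam Ty) (\<lambda>s. w s - Qy w s) \<le> approx_defect Ty Ny \<epsilon> w"
    and Qx_bound: "\<forall>v\<in>L2space (Lam Tx). L2norm (Lam Tx) (Qx v) \<le> \<kappa>x * L2norm (Lam Tx) v"
    and P: "rectangular_patch P \<or> one_side_curved_patch P"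
    and "h > 0" and Qhat: "Qhat = ref_square a h"
    and \<Psi>_onto: "\<Psi> ` Qhat = P"
    and \<Psi>_bilip: "bi_lipschitz_on Qhat \<Psi>"
    and "Jmin > 0"
    and \<Psi>_jac: "AE q in lebesgue_on Qhat. (\<Psi> has_derivative D\<Psi> q) (at q within Qhat) \<and>
          Jmin \<le> \<bar>det (matrix (D\<Psi> q))\<bar> \<and> \<bar>det (matrix (D\<Psi> q))\<bar> \<le> Jmax"
    and f: "f \<in> L2space P"
    and g\<^sub>P: "g\<^sub>P = f \<circ> \<Psi> \<circ> Lam_to_square a h Tx Ty"
    and G\<^sub>P: "G\<^sub>P = tensor_op Qx Qy g\<^sub>P"
    and F\<^sub>P: "F\<^sub>P = G\<^sub>P \<circ> square_to_Lam a h Tx Ty \<circ> the_inv_into Qhat \<Psi>"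
    \<comment> \<open>Jacobian of the affine map from \<open>\<Lambda>\<close> to the reference square; the bounds
        without \<open>\<rho>\<close> fail in general if \<open>\<rho> > 1\<close>\<close>
    and \<rho>: "\<rho> = measure lebesgue Qhat / measure lebesgue (Lam Tx \<times> Lam Ty)"
  shows "F\<^sub>P \<in> L2space P \<and>
    L2norm P (\<lambda>p. f p - F\<^sub>P p)
      \<le> sqrt (Jmax * \<rho>) * (err_x Tx Ty Qx g\<^sub>P + \<kappa>x * err_y Tx Ty Qy g\<^sub>P) \<and>
    L2norm P (\<lambda>p. f p - F\<^sub>P p)
      \<le> sqrt (Jmax * \<rho>) * (defect_x Tx Ty Nx \<epsilon> g\<^sub>P + \<kappa>x * defect_y Tx Ty Ny \<epsilon> g\<^sub>P) \<and>
    (\<rho> \<le> 1 \<longrightarrow>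
      L2norm P (\<lambda>p. f p - F\<^sub>P p)
        \<le> sqrt Jmax * (err_x Tx Ty Qx g\<^sub>P + \<kappa>x * err_y Tx Ty Qy g\<^sub>P) \<and>
      L2norm P (\<lambda>p. f p - F\<^sub>P p)
        \<le> sqrt Jmax * (defect_x Tx Ty Nx \<epsilon> g\<^sub>P + \<kappa>x * defect_y Tx Ty Ny \<epsilon> g\<^sub>P))"
proof -
  let ?\<Lambda> = "Lam Tx \<times> Lam Ty" and ?\<phi> = "Lam_to_square a h Tx Ty" and ?\<psi> = "square_to_Lam a h Tx Ty"
  have T: "Tx > 0" "Ty > 0" and \<epsilon>: "\<epsilon> \<ge> 0" using assms(1-3) by auto
  have RQx: "fourier_reconstruction Tx Nx Qx"
    by (rule fourier_reconstruction_of_error_bound[OF Qx_op \<epsilon> Qx_err])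
  have RQy: "fourier_reconstruction Ty Ny Qy"
    by (rule fourier_reconstruction_of_error_bound[OF Qy_op \<epsilon> Qy_err])
  have \<kappa>: "0 \<le> \<kappa>x" by (rule Lam_operator_bound_nonneg[OF \<open>Tx > 1\<close> Qx_bound])
  have Qc: "compact Qhat" unfolding Qhat ref_square_eq_cbox by (rule compact_cbox)
  have "box a (\<chi> i. a $ i + h) \<noteq> {}"
    using \<open>h > 0\<close> by (simp add: interval_ne_empty_cart)
  then have Qn: "\<not> negligible Qhat"
    unfolding Qhat ref_square_eq_cbox by (simp add: negligible_interval)
  note pull = L2space_bi_lipschitz_pullback[OF Qc Qn \<Psi>_bilip \<open>Jmin > 0\<close> \<Psi>_jac, unfolded \<Psi>_onto]
  note affine = L2_Lam_to_square[where a = a, OF \<open>h > 0\<close> T, folded Qhat, folded \<rho>]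
  have vim: "?\<phi> z \<in> Qhat \<longleftrightarrow> z \<in> ?\<Lambda>" for z
    using Lam_to_square_vimage_ref_square[OF \<open>h > 0\<close> T, of a] unfolding Qhat by blast
  have inverse: "?\<phi> (?\<psi> q) = q" "?\<psi> (?\<phi> z) = z" for q z
    using square_to_Lam_inverse[of h Tx Ty a] \<open>h > 0\<close> T by auto
  have inj: "inj_on \<Psi> Qhat" and inv: "\<exists>M. M-lipschitz_on P (the_inv_into Qhat \<Psi>)"
    and lip: "\<exists>L. L-lipschitz_on Qhat \<Psi>"
    using \<Psi>_bilip unfolding bi_lipschitz_on_def \<Psi>_onto by blast+
  have g: "g\<^sub>P \<in> L2space ?\<Lambda>"
    unfolding g\<^sub>P by (rule affine(1)[OF pull(2)[OF f]])
  have Pc: "compact P"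
    using lip Qc unfolding \<Psi>_onto[symmetric]
    by (auto intro: compact_continuous_image lipschitz_on_continuous_on)
  have "continuous_on P F\<^sub>P"
    unfolding F\<^sub>P comp_def
  proof (rule continuous_on_compose2[of ?\<Lambda> G\<^sub>P])
    show "continuous_on ?\<Lambda> G\<^sub>P"
      unfolding G\<^sub>P by (rule tensor_op_continuous[OF assms(1,2) RQx RQy g])
    show "continuous_on P (\<lambda>p. ?\<psi> (the_inv_into Qhat \<Psi> p))"
      using inv lipschitz_on_continuous_on
      by (intro continuous_on_compose2[OF square_to_Lam_continuous[of UNIV]]) auto
    show "(\<lambda>p. ?\<psi> (the_inv_into Qhat \<Psi> p)) ` P \<subseteq> ?\<Lambda>"
    proof (rule image_subsetI)
      fix p assume "p \<in> P"
      then have "the_inv_into Qhat \<Psi> p \<in> Qhat"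
        using the_inv_into_into[OF inj, of p Qhat] \<Psi>_onto by blast
      then show "?\<psi> (the_inv_into Qhat \<Psi> p) \<in> ?\<Lambda>"
        using vim inverse(1) by metis
    qed
  qed
  then have F: "F\<^sub>P \<in> L2space P" by (rule L2space_continuous[OF Pc])
  define r where "r = (\<lambda>p. f p - F\<^sub>P p)"
  have r: "r \<in> L2space P" unfolding r_def by (rule L2space_diff[OF f F])
  have rz: "(r \<circ> \<Psi> \<circ> ?\<phi>) z = g\<^sub>P z - tensor_op Qx Qy g\<^sub>P z" if "z \<in> ?\<Lambda>" for z
    using that by (simp add: r_def g\<^sub>P F\<^sub>P G\<^sub>P vim inverse the_inv_into_f_f[OF inj])
  define E where "E = err_x Tx Ty Qx g\<^sub>P + \<kappa>x * err_y Tx Ty Qy g\<^sub>P"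
  define D where "D = defect_x Tx Ty Nx \<epsilon> g\<^sub>P + \<kappa>x * defect_y Tx Ty Ny \<epsilon> g\<^sub>P"
  have E0: "0 \<le> E" using \<kappa> by (simp add: E_def err_x_def err_y_def)
  have J0: "0 \<le> Jmax" by (rule pull(1)[OF f])
  have \<rho>0: "0 \<le> \<rho>" by (simp add: \<rho>)
  have "L2norm ?\<Lambda> (r \<circ> \<Psi> \<circ> ?\<phi>) = L2norm ?\<Lambda> (\<lambda>z. g\<^sub>P z - tensor_op Qx Qy g\<^sub>P z)"
    by (rule L2norm_cong) (rule rz)
  also have "\<dots> \<le> E"
    unfolding E_def by (rule tensor_reconstruction_error[OF assms(1,2) RQx RQy Qx_bound \<kappa> g])
  finally have "sqrt \<rho> * L2norm ?\<Lambda> (r \<circ> \<Psi> \<circ> ?\<phi>) \<le> sqrt \<rho> * E"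
    using \<rho>0 by (intro mult_left_mono) auto
  then have "L2norm Qhat (r \<circ> \<Psi>) \<le> sqrt \<rho> * E"
    using affine(2)[OF pull(2)[OF r]] by simp
  then have "sqrt Jmax * L2norm Qhat (r \<circ> \<Psi>) \<le> sqrt Jmax * (sqrt \<rho> * E)"
    using J0 by (intro mult_left_mono) auto
  then have main: "L2norm P r \<le> sqrt (Jmax * \<rho>) * E"
    using pull(3)[OF r] by (simp add: real_sqrt_mult mult.assoc)
  have gs: "g\<^sub>P \<circ> prod.swap \<in> L2space (Lam Ty \<times> Lam Tx)"
    by (rule L2space_swap(2)[OF Lam_borel Lam_borel g])
  have "err_x Tx Ty Qx g\<^sub>P \<le> defect_x Tx Ty Nx \<epsilon> g\<^sub>P"
    using slice_error_le_defect[OF assms(1) RQx Lam_compact gs \<epsilon> Qx_err]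
    by (simp add: err_x_def defect_x_def)
  moreover have "err_y Tx Ty Qy g\<^sub>P \<le> defect_y Tx Ty Ny \<epsilon> g\<^sub>P"
    using slice_error_le_defect[OF assms(2) RQy Lam_compact g \<epsilon> Qy_err]
    by (simp only: err_y_def defect_y_def)
  ultimately have ED: "E \<le> D"
    unfolding E_def D_def using \<kappa> by (intro add_mono mult_left_mono)
  have "sqrt (Jmax * \<rho>) * E \<le> sqrt (Jmax * \<rho>) * D"
    using ED J0 \<rho>0 by (intro mult_left_mono) auto
  moreover have "sqrt (Jmax * \<rho>) * E \<le> sqrt Jmax * E" "sqrt Jmax * E \<le> sqrt Jmax * D" if "\<rho> \<le> 1"
    using ED E0 J0 \<rho>0 that by (auto intro!: mult_right_mono mult_left_mono mult_left_le)
  ultimately show ?thesis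
    using F main unfolding E_def[symmetric] D_def[symmetric] r_def[symmetric] by fastforce
qed

end
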